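(* Let $e\ge 3$, let $y\in[1,e-1]$ be rational and let $z$ be the denominator of $y$. Then $(ez,yz)$-regularisation defines an isomorphism of crystals $\mathcal R_{A^{y+}}\to\mathcal R_{A^{y-}}$, and the inverse isomorphism is given by $(ez,yz)$-restrictisation.
   Context: Nodes $(r,c)\in\mathbb N^2$ of a Young diagram; residue $c-r+e\mathbb Z$; $i$-node = node of residue $i\in\mathbb Z/e\mathbb Z$. Hook at $(r,c)$: length $\lambda_r-c+\lambda'_c-r+1$, arm length $\lambda_r-c$. An arm sequence is an integer sequence $A=(A_1,A_2,\dots)$ with $t-1\le A_t\le(e-1)t$ and $A_{t+u}\in\{A_t+A_u,A_t+A_u+1\}$ for all $t,u\ge1$; for real $y\in[1,e-1]$, $A^{y+}_t=\lfloor yt\rfloor$ and $A^{y-}_t=\lceil yt-1\rceil$ are arm sequences. A partition is $A$-regular if it has no hook of length $et$ and arm length $A_t$ for any $t\ge1$; $\mathcal R_A$ is the set of $A$-regular partitions. Crystal structure on $\mathcal R_A$: for distinct $i$-nodes $(r,c),(s,d)$ write $s-r+c-d=et$ with the nodes swapped if needed so $t\ge0$, and set $(r,c)\prec(s,d)$ if $c-d\le A_t$ ($A_0:=0$), $(r,c)\succ(s,d)$ otherwise; this is a total order on $i$-nodes. For $\lambda\in\mathcal R_A$ list the addable and removable $i$-nodes as $n_1\succ\dots\succ n_m$, form the signature $s_1\cdots s_m$ ($+$ addable, $-$ removable), and reduce it by repeatedly deleting adjacent pairs $+-$. If the reduced word has a $-$, $e_i\lambda$ is $\lambda$ with the node of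 the last $-$ removed, else $e_i\lambda=0$; if it has a $+$, $f_i\lambda$ is $\lambda$ with the node of the first $+$ added, else $f_i\lambda=0$. It is known that $e_i,f_i$ map $\mathcal R_A$ to $\mathcal R_A\cup\{0\}$ and $e_i\lambda=\mu\iff f_i\mu=\lambda$; the crystal $\mathcal R_A$ is the directed graph on $\mathcal R_A$ with arrows $\lambda\xrightarrow{i}f_i\lambda$. An isomorphism of crystals is a bijection $\alpha$ of vertex sets with $\lambda\xrightarrow{i}\mu$ iff $\alpha(\lambda)\xrightarrow{i}\alpha(\mu)$. For integers $1\le y'<e'$: the $(e',y')$-ladders are the sets $\{(r+k(y'-e'),c+ky'):k\in\mathbb Z\}$; partitions are $(e',y')$-equivalent if they have equally many nodes in each ladder; $(e',y')$-regular means no hook of length $e't$ and arm length $y't-1$ ($t\ge1$), $(e',y')$-restricted means no hook of length $e't$ and arm length $y't$. It is known that each equivalence class contains a unique $(e',y')$-regular partition (dominating all others in the class) and a unique $(e',y')$-restricted partition (dominated by all others); these are the $(e',y')$-regularisation and $(e',y')$-restrictisation of each member of the class. *)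

theory Defs
  imports Complex_Main
begin

type_synonym node = "nat \<times> nat"

text \<open>A partition is represented by its Young diagram: a finite set of nodes (r,c),
  r,c \<ge> 1, closed downwards (towards (1,1)).\<close>
definition is_partition :: "node set \<Rightarrow> bool" where
  "is_partition Y \<longleftrightarrow> finite Y \<and> (\<forall>(r,c)\<in>Y. 1 \<le> r \<and> 1 \<le> c) \<and>
     (\<forall>r c r' c'. (r,c) \<in> Y \<longrightarrow> 1 \<le> r' \<longrightarrow> r' \<le> r \<longrightarrow> 1 \<le> c' \<longrightarrow> c' \<le> c \<longrightarrow> (r',c') \<in> Y)"

definition row_len :: "node set \<Rightarrow> nat \<Rightarrow> nat" where
  "row_len Y r = card {c. (r,c) \<in> Y}"

definition col_len :: "node set \<Rightarrow> nat \<Rightarrow> nat" where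
  "col_len Y c = card {r. (r,c) \<in> Y}"

definition hook_len :: "node set \<Rightarrow> node \<Rightarrow> int" where
  "hook_len Y n = (case n of (r,c) \<Rightarrow>
      int (row_len Y r) - int c + int (col_len Y c) - int r + 1)"

definition arm_len :: "node set \<Rightarrow> node \<Rightarrow> int" where
  "arm_len Y n = (case n of (r,c) \<Rightarrow> int (row_len Y r) - int c)"

definition residue :: "nat \<Rightarrow> node \<Rightarrow> int" where
  "residue e n = (case n of (r,c) \<Rightarrow> (int c - int r) mod int e)"

text \<open>Arm sequences (indexed by t \<ge> 1; the value at 0 is irrelevant).\<close>
definition is_arm_sequence :: "nat \<Rightarrow> (nat \<Rightarrow> int) \<Rightarrow> bool" where
  "is_arm_sequence e A \<longleftrightarrow>
     (\<forall>t\<ge>1. int t - 1 \<le> A t \<and> A t \<le> (int e - 1) * int t) \<and>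
     (\<forall>t\<ge>1. \<forall>u\<ge>1. A (t+u) \<in> {A t + A u, A t + A u + 1})"

definition A_plus :: "rat \<Rightarrow> nat \<Rightarrow> int" where
  "A_plus y t = \<lfloor>y * of_nat t\<rfloor>"

definition A_minus :: "rat \<Rightarrow> nat \<Rightarrow> int" where
  "A_minus y t = \<lceil>y * of_nat t - 1\<rceil>"

definition A_regular :: "nat \<Rightarrow> (nat \<Rightarrow> int) \<Rightarrow> node set \<Rightarrow> bool" where
  "A_regular e A Y \<longleftrightarrow> is_partition Y \<and>
     \<not> (\<exists>n\<in>Y. \<exists>t\<ge>1. hook_len Y n = int e * int t \<and> arm_len Y n = A t)"

definition R_A :: "nat \<Rightarrow> (nat \<Rightarrow> int) \<Rightarrow> node set set" where
  "R_A e A = {Y. A_regular e A Y}"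

definition addable :: "node set \<Rightarrow> node set" where
  "addable Y = {(r,c). 1 \<le> r \<and> 1 \<le> c \<and> (r,c) \<notin> Y \<and> is_partition (insert (r,c) Y)}"

definition removable :: "node set \<Rightarrow> node set" where
  "removable Y = {n \<in> Y. is_partition (Y - {n})}"

text \<open>The order on i-nodes: node_prec e A n1 n2 means n1 \<prec> n2 (for distinct i-nodes).
  With n1=(r,c), n2=(s,d), s-r+c-d = e t; if t \<ge> 0 then n1 \<prec> n2 iff c-d \<le> A_t;
  otherwise the nodes are swapped and n1 \<prec> n2 iff not (n2 \<prec> n1), i.e. d-c > A_{-t}.
  Here A_0 = 0.\<close>
definition node_prec :: "nat \<Rightarrow> (nat \<Rightarrow> int) \<Rightarrow> node \<Rightarrow> node \<Rightarrow> bool" where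
  "node_prec e A n1 n2 = (case n1 of (r,c) \<Rightarrow> case n2 of (s,d) \<Rightarrow>
     (let t = (int s - int r + int c - int d) div int e;
          A0 = (\<lambda>k::nat. if k = 0 then 0 else A k) in
      if t \<ge> 0 then int c - int d \<le> A0 (nat t)
      else \<not> (int d - int c \<le> A0 (nat (- t)))))"

text \<open>The signature list n_1 \<succ> ... \<succ> n_m of addable and removable i-nodes,
  each tagged True (+, addable) or False (-, removable).\<close>
definition i_signature :: "nat \<Rightarrow> (nat \<Rightarrow> int) \<Rightarrow> int \<Rightarrow> node set \<Rightarrow> (bool \<times> node) list" where
  "i_signature e A i Y =
     (let S = {n \<in> addable Y \<union> removable Y. residue e n = i mod int e};
          ns = (THE ns. distinct ns \<and> set ns = S \<and> sorted_wrt (\<lambda>a b. node_prec e A b a) ns)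
      in map (\<lambda>n. (n \<in> addable Y, n)) ns)"

definition sig_step :: "(bool \<times> node) list \<Rightarrow> (bool \<times> node) list \<Rightarrow> bool" where
  "sig_step w w' \<longleftrightarrow> (\<exists>xs ys a b. w = xs @ [(True,a),(False,b)] @ ys \<and> w' = xs @ ys)"

definition sig_reduce :: "(bool \<times> node) list \<Rightarrow> (bool \<times> node) list" where
  "sig_reduce w = (THE w'. sig_step\<^sup>*\<^sup>* w w' \<and> \<not> (\<exists>w''. sig_step w' w''))"

text \<open>f_i, with None standing for 0.\<close>
definition f_op :: "nat \<Rightarrow> (nat \<Rightarrow> int) \<Rightarrow> int \<Rightarrow> node set \<Rightarrow> node set option" where
  "f_op e A i Y = (case find fst (sig_reduce (i_signature e A i Y)) of
       None \<Rightarrow> None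
     | Some (_, n) \<Rightarrow> Some (insert n Y))"

text \<open>Arrow Y --i--> Z in the crystal R_A (i ranges over Z/eZ, represented by 0..e-1).\<close>
definition crystal_arrow :: "nat \<Rightarrow> (nat \<Rightarrow> int) \<Rightarrow> node set \<Rightarrow> int \<Rightarrow> node set \<Rightarrow> bool" where
  "crystal_arrow e A Y i Z \<longleftrightarrow> Y \<in> R_A e A \<and> Z \<in> R_A e A \<and> 0 \<le> i \<and> i < int e \<and>
     f_op e A i Y = Some Z"

definition crystal_iso :: "nat \<Rightarrow> (nat \<Rightarrow> int) \<Rightarrow> (nat \<Rightarrow> int) \<Rightarrow> (node set \<Rightarrow> node set) \<Rightarrow> bool" where
  "crystal_iso e A B \<alpha> \<longleftrightarrow> bij_betw \<alpha> (R_A e A) (R_A e B) \<and>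
     (\<forall>Y\<in>R_A e A. \<forall>Z\<in>R_A e A. \<forall>i.
        crystal_arrow e A Y i Z \<longleftrightarrow> crystal_arrow e B (\<alpha> Y) i (\<alpha> Z))"

definition ladder :: "nat \<Rightarrow> nat \<Rightarrow> node \<Rightarrow> node set" where
  "ladder e' y' n = (case n of (r,c) \<Rightarrow>
     {(r',c'). \<exists>k::int. int r' = int r + k * (int y' - int e') \<and> int c' = int c + k * int y'})"

definition ladder_equiv :: "nat \<Rightarrow> nat \<Rightarrow> node set \<Rightarrow> node set \<Rightarrow> bool" where
  "ladder_equiv e' y' Y Z \<longleftrightarrow> (\<forall>n. card (Y \<inter> ladder e' y' n) = card (Z \<inter> ladder e' y' n))"

definition ey_regular :: "nat \<Rightarrow> nat \<Rightarrow> node set \<Rightarrow> bool" where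
  "ey_regular e' y' Y \<longleftrightarrow> \<not> (\<exists>n\<in>Y. \<exists>t\<ge>1.
      hook_len Y n = int e' * int t \<and> arm_len Y n = int y' * int t - 1)"

definition ey_restricted :: "nat \<Rightarrow> nat \<Rightarrow> node set \<Rightarrow> bool" where
  "ey_restricted e' y' Y \<longleftrightarrow> \<not> (\<exists>n\<in>Y. \<exists>t\<ge>1.
      hook_len Y n = int e' * int t \<and> arm_len Y n = int y' * int t)"

definition regularisation :: "nat \<Rightarrow> nat \<Rightarrow> node set \<Rightarrow> node set" where
  "regularisation e' y' Y =
     (THE Z. is_partition Z \<and> ladder_equiv e' y' Z Y \<and> ey_regular e' y' Z)"

definition restrictisation :: "nat \<Rightarrow> nat \<Rightarrow> node set \<Rightarrow> node set" where
  "restrictisation e' y' Y =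
     (THE Z. is_partition Z \<and> ladder_equiv e' y' Z Y \<and> ey_restricted e' y' Z)"

end

theory Submission
  imports Defs "HOL-Computational_Algebra.Polynomial"
begin

text \<open>Write \<open>y = p / z\<close>, \<open>q = e z - p\<close>, and give the node \<open>(r,c)\<close> the height \<open>p r + q c\<close>. The
  \<open>(e z, p)\<close>-ladders are the nodes of a given residue and height. Both crystal orders compare
  heights first; they differ only in how the column breaks ties within a ladder. For either order,
  a partition is regular iff no hook of length divisible by \<open>e\<close> has the node below its foot
  strictly between its hand node and the diagonal successor of its hand node. Consequently no addable node of a regular partition lies
  between a removable node of the same residue and its diagonal successor.

  Hence the nodes of residue \<open>i\<close> that are addable of height at most \<open>K\<close>, or removable of height at
  most \<open>K - e z\<close>, form a suffix of the signature, and the number of its addable minus the number of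
  its removable nodes depends only on the ladder class. The height of the node added by \<open>f\<^sub>i\<close> is the
  least \<open>K\<close> maximising this number, and the node removed by \<open>e\<^sub>i\<close> is found from the greatest
  such \<open>K\<close>. So \<open>e\<^sub>i\<close> and \<open>f\<^sub>i\<close> act alike on ladder-equivalent regular partitions for both orders, and
  induction on the size gives existence and uniqueness of regular partitions in a class.\<close>

section \<open>Reduction of signatures\<close>

text \<open>The obstacle is that a suffix of the signature depends on how ties are broken, while
  ladder counts do not see ties. Moving each removable node to its diagonal successor, which has the
  same residue and is \<open>p + q = e z\<close> higher, removes this dependence: the signed count
  of corners so placed is a second difference of the diagram, hence linear in it and readable from
  ladder counts. Regularity supplies the gap that keeps such height cuts suffixes. Height alone does
  not determine a ladder, because \<open>p\<close> and \<open>q\<close> may share a factor; the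
  residue separates the remaining cases, as \<open>p\<close> and \<open>z\<close> are coprime. The
  pair \<open>(e z, p)\<close> itself fits the scheme, with modulus \<open>e z\<close> and
  denominator 1: heights and tie-breaks stay the same, and a partition regular for modulus
  \<open>e\<close> passes the weaker test modulo \<open>e z\<close>. So the definite descriptions of
  regularisation and restrictisation are resolved with existence from modulus \<open>e\<close> and
  uniqueness from modulus \<open>e z\<close>.\<close>

fun bracket :: "(bool \<times> node) list \<Rightarrow> (bool \<times> node) list" where
  "bracket [] = []"
| "bracket (x # w) =
     (if fst x \<and> bracket w \<noteq> [] \<and> \<not> fst (hd (bracket w)) then tl (bracket w) else x # bracket w)"

lemma bracket_append_cong: "bracket u = bracket v \<Longrightarrow> bracket (w @ u) = bracket (w @ v)"
  by (induction w) auto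

lemma bracket_sig_step:
  assumes "sig_step w w'"
  shows "bracket w = bracket w'"
proof -
  obtain xs ys a b where w: "w = xs @ [(True,a),(False,b)] @ ys" "w' = xs @ ys"
    using assms by (auto simp: sig_step_def)
  have "bracket ([(True,a),(False,b)] @ ys) = bracket ys" by simp
  then show ?thesis unfolding w by (rule bracket_append_cong)
qed

lemma sig_step_Cons: "sig_step w w' \<Longrightarrow> sig_step (x # w) (x # w')"
  unfolding sig_step_def by (metis append_Cons)

lemma sig_steps_Cons: "sig_step\<^sup>*\<^sup>* w w' \<Longrightarrow> sig_step\<^sup>*\<^sup>* (x # w) (x # w')"
  by (induction rule: rtranclp_induct) (auto intro: sig_step_Cons rtranclp.rtrancl_into_rtrancl)

lemma sig_steps_bracket: "sig_step\<^sup>*\<^sup>* w (bracket w)"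
proof (induction w)
  case (Cons x w)
  have 1: "sig_step\<^sup>*\<^sup>* (x # w) (x # bracket w)" using Cons.IH by (rule sig_steps_Cons)
  show ?case
  proof (cases "fst x \<and> bracket w \<noteq> [] \<and> \<not> fst (hd (bracket w))")
    case True
    then obtain a b u where "x = (True,a)" "bracket w = (False,b) # u"
      by (cases x; cases "bracket w") auto
    then have "sig_step (x # bracket w) (tl (bracket w))"
      unfolding sig_step_def by (intro exI[of _ "[]"] exI[of _ u] exI[of _ a] exI[of _ b]) simp
    with 1 True show ?thesis by simp
  qed (use 1 in auto)
qed simp

lemma bracket_normal:
  assumes "\<nexists>w'. sig_step w w'"
  shows "bracket w = w"
  using assms
proof (induction w)
  case (Cons x w)
  have "bracket w = w" using Cons sig_step_Cons by blast
  moreover have "\<not> (fst x \<and> w \<noteq> [] \<and> \<not> fst (hd w))"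
  proof
    assume "fst x \<and> w \<noteq> [] \<and> \<not> fst (hd w)"
    then obtain a b u where "x = (True,a)" "w = (False,b) # u" by (cases x; cases w) auto
    then have "sig_step (x # w) u"
      unfolding sig_step_def by (intro exI[of _ "[]"] exI[of _ u] exI[of _ a] exI[of _ b]) simp
    with Cons.prems show False by blast
  qed
  ultimately show ?case by auto
qed simp

section \<open>Suffix values of a signature\<close>

definition val :: "(bool \<times> node) list \<Rightarrow> int" where
  "val w = (\<Sum>x\<leftarrow>w. if fst x then 1 else -1)"

lemma val_simps [simp]:
  "val [] = 0" "val (x # w) = (if fst x then 1 else -1) + val w"
  by (simp_all add: val_def)

text \<open>In the reduced word \<open>N @ P\<close> the length of \<open>P\<close> is the largest value of a suffix of \<open>w\<close>, and
  the head of \<open>P\<close> begins the shortest suffix attaining it.\<close>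
lemma bracket_shape:
  "\<exists>N P. bracket w = N @ P \<and> (\<forall>x\<in>set N. \<not> fst x) \<and> (\<forall>x\<in>set P. fst x)
     \<and> val w = int (length P) - int (length N)
     \<and> (\<forall>a b. w = a @ b \<longrightarrow> val b \<le> int (length P))
     \<and> (P \<noteq> [] \<longrightarrow> (\<exists>u v. w = u @ hd P # v \<and> val (hd P # v) = int (length P)
            \<and> (\<forall>a b. v = a @ b \<longrightarrow> val b < int (length P))))"
proof (induction w)
  case (Cons x w)
  then obtain N P where NP: "bracket w = N @ P" "\<forall>x\<in>set N. \<not> fst x" "\<forall>x\<in>set P. fst x"
    "val w = int (length P) - int (length N)"
    "\<forall>a b. w = a @ b \<longrightarrow> val b \<le> int (length P)"
    "P \<noteq> [] \<longrightarrow> (\<exists>u v. w = u @ hd P # v \<and> val (hd P # v) = int (length P)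
            \<and> (\<forall>a b. v = a @ b \<longrightarrow> val b < int (length P)))"
    by blast
  have ext: "P \<noteq> [] \<longrightarrow> (\<exists>u v. x # w = u @ hd P # v \<and> val (hd P # v) = int (length P)
            \<and> (\<forall>a b. v = a @ b \<longrightarrow> val b < int (length P)))"
    using NP(6) by (metis append_Cons)
  have suf: "val b \<le> k" if "x # w = a @ b" "val (x # w) \<le> k" "int (length P) \<le> k" for a b k
    using that NP(5) by (cases a) (auto intro: order_trans)
  consider "\<not> fst x" | "fst x" "N \<noteq> []" | "fst x" "N = []" by blast
  then show ?case
  proof cases
    case 1
    have v: "val (x # w) \<le> int (length P)" using 1 NP(4) by simp
    have "\<forall>a b. x # w = a @ b \<longrightarrow> val b \<le> int (length P)"
      using suf[OF _ v order_refl] by blast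
    with 1 NP ext show ?thesis by (intro exI[of _ "x # N"] exI[of _ P]) simp
  next
    case 2
    \<comment> \<open>The new plus cancels the first minus of \<open>N\<close>; since
      \<open>val w\<close> was below \<open>length P\<close>, no suffix exceeds the old
      maximum.\<close>
    have v: "val (x # w) \<le> int (length P)" using 2 NP(4) by (cases N) auto
    have "\<forall>a b. x # w = a @ b \<longrightarrow> val b \<le> int (length P)"
      using suf[OF _ v order_refl] by blast
    moreover have "bracket (x # w) = tl N @ P" using 2 NP by (cases N) auto
    ultimately show ?thesis using 2 NP ext
      by (intro exI[of _ "tl N"] exI[of _ P]) (cases N; simp)
  next
    case 3
    \<comment> \<open>No minus is left, so \<open>w\<close> already has the maximal value, and
      \<open>x # w\<close> is the only suffix to exceed it.\<close>
    have v: "val (x # w) \<le> int (length (x # P))" using 3 NP(4) by simp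
    have "\<forall>a b. x # w = a @ b \<longrightarrow> val b \<le> int (length (x # P))"
      using suf[OF _ v] by (metis impossible_Cons linorder_linear of_nat_mono)
    moreover have "bracket (x # w) = x # P" using 3 NP by (cases P) auto
    moreover have "\<exists>u v. x # w = u @ hd (x # P) # v \<and> val (hd (x # P) # v) = int (length (x # P))
            \<and> (\<forall>a b. v = a @ b \<longrightarrow> val b < int (length (x # P)))"
    proof (intro exI conjI allI impI)
      show "x # w = [] @ hd (x # P) # w" by simp
      show "val (hd (x # P) # w) = int (length (x # P))" using 3 NP(4) by simp
      fix a b assume "w = a @ b"
      then have "val b \<le> int (length P)" using NP(5) by blast
      then show "val b < int (length (x # P))" by simp
    qed
    moreover have "val (x # w) = int (length (x # P)) - int (length [])" using 3 NP(4) by simp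
    ultimately show ?thesis using 3(1) NP(3)
      by (intro exI[of _ "[]"] exI[of _ "x # P"]) (simp del: val_simps)
  qed
qed simp

lemma no_sig_step_bracket: "\<not> sig_step (bracket w) w'"
proof
  assume "sig_step (bracket w) w'"
  then obtain xs ys a b where s: "bracket w = xs @ (True,a) # (False,b) # ys"
    by (auto simp: sig_step_def)
  obtain N P where NP: "bracket w = N @ P" "\<forall>x\<in>set N. \<not> fst x" "\<forall>x\<in>set P. fst x"
    using bracket_shape[of w] by blast
  have "N @ P = xs @ (True,a) # (False,b) # ys" using s NP by simp
  then consider us where "N = xs @ us" "us @ P = (True,a) # (False,b) # ys"
    | us where "N @ us = xs" "P = us @ (True,a) # (False,b) # ys"
    by (auto simp: append_eq_append_conv2)
  then show False
  proof cases
    case (1 us)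
    then show False using NP(2,3) by (cases us) auto
  next
    case (2 us)
    then show False using NP(3) by auto
  qed
qed

text \<open>\<open>bracket\<close> is invariant under deletion and fixes irreducible words, so the
  normal form is unique without a diamond argument.\<close>

lemma sig_reduce_eq_bracket: "sig_reduce w = bracket w"
  unfolding sig_reduce_def
proof (rule the_equality)
  show "sig_step\<^sup>*\<^sup>* w (bracket w) \<and> (\<nexists>w''. sig_step (bracket w) w'')"
    using sig_steps_bracket no_sig_step_bracket by blast
next
  fix w' assume w': "sig_step\<^sup>*\<^sup>* w w' \<and> (\<nexists>w''. sig_step w' w'')"
  then have "sig_step\<^sup>*\<^sup>* w w'" by blast
  then have "bracket w = bracket w'"
    by (induction rule: rtranclp_induct) (auto dest: bracket_sig_step)
  with w' show "w' = bracket w" using bracket_normal by metis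
qed

lemma first_plus_cases:
  obtains n u v where "find fst (sig_reduce w) = Some (True, n)" "w = u @ (True, n) # v"
      "\<And>a b. w = a @ b \<Longrightarrow> val b \<le> val ((True, n) # v)"
      "\<And>a b. v = a @ b \<Longrightarrow> val b < val ((True, n) # v)"
  | "find fst (sig_reduce w) = None" "\<And>a b. w = a @ b \<Longrightarrow> val b \<le> 0"
proof -
  obtain N P where NP: "bracket w = N @ P" "\<forall>x\<in>set N. \<not> fst x" "\<forall>x\<in>set P. fst x"
    "\<forall>a b. w = a @ b \<longrightarrow> val b \<le> int (length P)"
    "P \<noteq> [] \<longrightarrow> (\<exists>u v. w = u @ hd P # v \<and> val (hd P # v) = int (length P)
            \<and> (\<forall>a b. v = a @ b \<longrightarrow> val b < int (length P)))"
    using bracket_shape[of w] by blast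
  have N: "find fst (N @ xs) = find fst xs" for xs using NP(2) by (induction N) auto
  show thesis
  proof (cases P)
    case Nil
    with NP N[of "[]"] that(2) show thesis by (auto simp: sig_reduce_eq_bracket)
  next
    case (Cons x P')
    with NP(3) obtain n where n: "x = (True, n)" by (cases x) auto
    from NP(5) Cons obtain u v where uv: "w = u @ x # v" "val (x # v) = int (length P)"
      "\<forall>a b. v = a @ b \<longrightarrow> val b < int (length P)" by auto
    have "find fst (sig_reduce w) = Some (True, n)"
      using NP(1) N Cons n by (simp add: sig_reduce_eq_bracket)
    with uv NP(4) n that(1) show thesis by metis
  qed
qed

section \<open>Good and cogood nodes of a signed set\<close>

text \<open>With \<open>n\<^sub>1 \<succ> \<dots> \<succ> n\<^sub>m\<close> the suffixes of the signature are its downsets. The first uncancelled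
  plus is the top of the smallest downset of maximal sum, and the last uncancelled minus is
  the node just above the largest downset of maximal sum.\<close>

definition downset :: "('a \<Rightarrow> 'k::linorder) \<Rightarrow> 'a set \<Rightarrow> 'a set \<Rightarrow> bool" where
  "downset k S D \<longleftrightarrow> D \<subseteq> S \<and> (\<forall>m\<in>D. \<forall>n\<in>S. k n \<le> k m \<longrightarrow> n \<in> D)"

definition cogood :: "('a \<Rightarrow> 'k::linorder) \<Rightarrow> ('a \<Rightarrow> int) \<Rightarrow> 'a set \<Rightarrow> 'a \<Rightarrow> bool" where
  "cogood k sg S x \<longleftrightarrow> x \<in> S \<and> sg x = 1 \<and>
     (\<forall>D. downset k S D \<longrightarrow> sum sg D \<le> sum sg {n\<in>S. k n \<le> k x} \<and>
        (x \<notin> D \<longrightarrow> sum sg D < sum sg {n\<in>S. k n \<le> k x}))"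

definition good :: "('a \<Rightarrow> 'k::linorder) \<Rightarrow> ('a \<Rightarrow> int) \<Rightarrow> 'a set \<Rightarrow> 'a \<Rightarrow> bool" where
  "good k sg S x \<longleftrightarrow> x \<in> S \<and> sg x = -1 \<and>
     (\<forall>D. downset k S D \<longrightarrow> sum sg D \<le> sum sg {n\<in>S. k n < k x} \<and>
        (x \<in> D \<longrightarrow> sum sg D < sum sg {n\<in>S. k n < k x}))"

lemma downset_empty: "downset k S {}"
  by (simp add: downset_def)

lemma downset_le: "downset k S {n\<in>S. k n \<le> b}"
  by (auto simp: downset_def)

lemma downset_less: "downset k S {n\<in>S. k n < b}"
  by (auto simp: downset_def)

lemma downset_linear:
  assumes "downset k S D" "downset k S E"
  shows "D \<subseteq> E \<or> E \<subseteq> D"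
proof (rule ccontr)
  assume "\<not> (D \<subseteq> E \<or> E \<subseteq> D)"
  then obtain x y where "x \<in> D" "x \<notin> E" "y \<in> E" "y \<notin> D" by blast
  with assms show False unfolding downset_def by (meson linear subset_iff)
qed

lemma finite_downsets: "finite S \<Longrightarrow> finite {D. downset k S D}"
  by (rule finite_subset[of _ "Pow S"]) (auto simp: downset_def)

lemma cogood_unique:
  assumes "cogood k sg S x" "cogood k sg S y" "inj_on k S"
  shows "x = y"
proof (rule ccontr)
  have aux: False if "cogood k sg S x" "cogood k sg S y" "k x < k y" for x y
  proof -
    have "sum sg {n\<in>S. k n \<le> k x} < sum sg {n\<in>S. k n \<le> k y}"
      using that downset_le[of k S "k x"] unfolding cogood_def by auto
    moreover have "sum sg {n\<in>S. k n \<le> k y} \<le> sum sg {n\<in>S. k n \<le> k x}"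
      using that downset_le[of k S "k y"] unfolding cogood_def by auto
    ultimately show False by simp
  qed
  assume "x \<noteq> y"
  then have "k x \<noteq> k y" using assms by (auto simp: cogood_def inj_on_def)
  then show False using aux assms by (metis neq_iff)
qed

text \<open>Take the smallest among the downsets of maximal sum. Deleting its top element leaves a
  downset of strictly smaller sum, so that element is positive. \<open>D0\<close> keeps the chosen
  downset nonempty.\<close>

lemma ex_cogood:
  fixes k :: "'a \<Rightarrow> 'k::linorder"
  assumes fin: "finite S" and inj: "inj_on k S" and sg: "\<And>n. n \<in> S \<Longrightarrow> sg n = 1 \<or> sg n = -1"
    and D0: "downset k S D0" "sum sg D0 > 0"
  shows "\<exists>x. cogood k sg S x"
proof -
  let ?F = "{D. downset k S D}"
  define M where "M = Max (sum sg ` ?F)"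
  have finF: "finite ?F" using fin by (rule finite_downsets)
  have M: "sum sg D \<le> M" if "downset k S D" for D
    unfolding M_def using that finF by (intro Max_ge) auto
  have "M \<in> sum sg ` ?F" unfolding M_def using finF D0 by (intro Max_in) auto
  then obtain D1 where "downset k S D1 \<and> sum sg D1 = M" by auto
  from ex_has_least_nat[of "\<lambda>D. downset k S D \<and> sum sg D = M", OF this, of card]
  obtain D where D: "downset k S D" "sum sg D = M"
    and least: "\<And>E. downset k S E \<Longrightarrow> sum sg E = M \<Longrightarrow> card D \<le> card E"
    by blast
  have DS: "D \<subseteq> S" using D by (simp add: downset_def)
  then have finD: "finite D" using fin by (rule finite_subset)
  have "D \<noteq> {}" using D M[OF D0(1)] D0(2) by auto
  then have "Max (k ` D) \<in> k ` D" using finD by (intro Max_in) auto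
  then obtain x where "x \<in> D" "k x = Max (k ` D)" by auto
  then have x: "x \<in> D" "\<And>n. n \<in> D \<Longrightarrow> k n \<le> k x" using finD by auto
  have Deq: "D = {n\<in>S. k n \<le> k x}" using D x DS by (auto simp: downset_def)
  have strict: "sum sg E < sum sg D" if E: "downset k S E" "x \<notin> E" for E
  proof -
    have "E \<subset> D" using downset_linear[OF E(1) D(1)] E(2) x(1) by blast
    then have "card E < card D" using finD by (rule psubset_card_mono[rotated])
    then show ?thesis using least[OF E(1)] M[OF E(1)] D(2) by force
  qed
  have "downset k S (D - {x})"
    unfolding downset_def
  proof (intro conjI ballI impI)
    show "D - {x} \<subseteq> S" using DS by blast
    fix m n assume mn: "m \<in> D - {x}" "n \<in> S" "k n \<le> k m"
    then have "n \<in> D" using D by (auto simp: downset_def)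
    moreover have "n \<noteq> x"
    proof
      assume "n = x"
      then have "k m = k x" using mn x(2)[of m] by simp
      then have "m = x" using inj mn x(1) DS unfolding inj_on_def by blast
      with mn show False by simp
    qed
    ultimately show "n \<in> D - {x}" by blast
  qed
  then have "sum sg (D - {x}) < sum sg D" using strict by blast
  then have "sg x > 0" using finD x(1) by (simp add: sum_diff1)
  then have "sg x = 1" using sg x(1) DS by force
  moreover have "sum sg E \<le> sum sg D" if "downset k S E" for E using M[OF that] D(2) by simp
  ultimately have "cogood k sg S x"
    unfolding cogood_def Deq[symmetric] using x(1) DS strict by blast
  then show ?thesis ..
qed

text \<open>Dual choice: the largest downset of maximal sum, obtained by minimising the complement.
  \<open>D0\<close> shows that it is not all of \<open>S\<close>, so there is an element just above
  it.\<close>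

lemma ex_good:
  fixes k :: "'a \<Rightarrow> 'k::linorder"
  assumes fin: "finite S" and inj: "inj_on k S" and sg: "\<And>n. n \<in> S \<Longrightarrow> sg n = 1 \<or> sg n = -1"
    and D0: "downset k S D0" "sum sg D0 > sum sg S"
  shows "\<exists>x. good k sg S x"
proof -
  let ?F = "{D. downset k S D}"
  define M where "M = Max (sum sg ` ?F)"
  have finF: "finite ?F" using fin by (rule finite_downsets)
  have M: "sum sg D \<le> M" if "downset k S D" for D
    unfolding M_def using that finF by (intro Max_ge) auto
  have "M \<in> sum sg ` ?F" unfolding M_def using finF D0 by (intro Max_in) auto
  then obtain D1 where "downset k S D1 \<and> sum sg D1 = M" by auto
  from ex_has_least_nat[of "\<lambda>D. downset k S D \<and> sum sg D = M", OF this, of "\<lambda>D. card (S - D)"]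
  obtain D where D: "downset k S D" "sum sg D = M"
    and least: "\<And>E. downset k S E \<Longrightarrow> sum sg E = M \<Longrightarrow> card (S - D) \<le> card (S - E)"
    by blast
  have DS: "D \<subseteq> S" using D by (simp add: downset_def)
  have "S - D \<noteq> {}" using D M[OF D0(1)] D0(2) DS by auto
  then have "Min (k ` (S - D)) \<in> k ` (S - D)" using fin by (intro Min_in) auto
  then obtain x where "x \<in> S" "x \<notin> D" "k x = Min (k ` (S - D))" by auto
  then have x: "x \<in> S" "x \<notin> D" "\<And>n. n \<in> S \<Longrightarrow> n \<notin> D \<Longrightarrow> k x \<le> k n" using fin by auto
  have Deq: "D = {n\<in>S. k n < k x}"
  proof -
    have "k n < k x" if "n \<in> D" for n
      using that D x(1,2) unfolding downset_def by (meson not_le)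
    then show ?thesis using x(3) DS by (auto simp: not_less[symmetric])
  qed
  have strict: "sum sg E < sum sg D" if E: "downset k S E" "x \<in> E" for E
  proof -
    have "D \<subset> E" using downset_linear[OF E(1) D(1)] E(2) x(2) by blast
    moreover have "E \<subseteq> S" using E by (simp add: downset_def)
    ultimately have "S - E \<subset> S - D" by blast
    then have "card (S - E) < card (S - D)" using fin by (intro psubset_card_mono) auto
    then show ?thesis using least[OF E(1)] M[OF E(1)] D(2) by force
  qed
  have "insert x D = {n\<in>S. k n \<le> k x}"
    using Deq x(1) inj by (auto simp: inj_on_def order.order_iff_strict)
  then have "sum sg (insert x D) < sum sg D" using strict[OF downset_le[of k S "k x"]] x(1) by simp
  then have "sg x < 0" using x(2) finite_subset[OF DS fin] by simp
  then have "sg x = -1" using sg x(1) by force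
  moreover have "sum sg E \<le> sum sg D" if "downset k S E" for E using M[OF that] D(2) by simp
  ultimately have "good k sg S x"
    unfolding good_def Deq[symmetric] using x(1) strict by blast
  then show ?thesis ..
qed

lemma sum_le_split:
  fixes k :: "'a \<Rightarrow> 'k::linorder" and sg :: "'a \<Rightarrow> int"
  assumes "finite S" "inj_on k S" "x \<in> S"
  shows "sum sg {n\<in>S. k n \<le> k x} = sum sg {n\<in>S. k n < k x} + sg x"
proof -
  have "{n\<in>S. k n \<le> k x} = insert x {n\<in>S. k n < k x}"
    using assms by (auto simp: inj_on_def order.order_iff_strict)
  then show ?thesis using assms by simp
qed

text \<open>This is the relation between \<open>e_i\<close> and \<open>f_i\<close>. Flipping
  \<open>x\<close> raises by 2 exactly the downsets containing \<open>x\<close>; these were below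
  the maximum before, so the new maximum is one higher and every maximiser contains
  \<open>x\<close>.\<close>

lemma good_imp_cogood_flip:
  assumes g: "good k sg S x" and fin: "finite S" and inj: "inj_on k S"
    and flip: "\<And>n. n \<in> S \<Longrightarrow> n \<noteq> x \<Longrightarrow> sg' n = sg n" "sg' x = 1"
  shows "cogood k sg' S x"
proof -
  have x: "x \<in> S" "sg x = -1" using g by (auto simp: good_def)
  have out: "sum sg' D = sum sg D" if "D \<subseteq> S" "x \<notin> D" for D
    using that flip(1) by (intro sum.cong) auto
  have "in": "sum sg' D = sum sg D + 2" if D: "D \<subseteq> S" "x \<in> D" for D
  proof -
    have "finite D" using D fin finite_subset by blast
    then show ?thesis using out[of "D - {x}"] D x flip out[of "D - {x}"]
      sum.remove[of D x sg] sum.remove[of D x sg'] by auto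
  qed
  have top: "sum sg' {n\<in>S. k n \<le> k x} = sum sg {n\<in>S. k n < k x} + 1"
    using "in"[of "{n\<in>S. k n \<le> k x}"] x sum_le_split[OF fin inj x(1), of sg] by auto
  have le: "sum sg' D \<le> sum sg {n\<in>S. k n < k x} + (if x \<in> D then 1 else 0)" 
    if "downset k S D" for D
  proof -
    have "D \<subseteq> S" using that by (simp add: downset_def)
    moreover have "sum sg D \<le> sum sg {n\<in>S. k n < k x}"
      "x \<in> D \<longrightarrow> sum sg D < sum sg {n\<in>S. k n < k x}" using g that by (auto simp: good_def)
    ultimately show ?thesis using "in"[of D] out[of D] by auto
  qed
  have "sum sg' D \<le> sum sg' {n\<in>S. k n \<le> k x} \<and>
      (x \<notin> D \<longrightarrow> sum sg' D < sum sg' {n\<in>S. k n \<le> k x})" if "downset k S D" for D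
    using le[OF that] top by (cases "x \<in> D") auto
  then show ?thesis unfolding cogood_def using x flip(2) by blast
qed

text \<open>If only pluses stood between \<open>x\<close> and \<open>m\<close>, extending the
  downset of \<open>x\<close> up to \<open>m\<close> would increase its sum.\<close>

lemma cogood_above:
  assumes g: "cogood k sg S x" and fin: "finite S" and inj: "inj_on k S"
    and sg: "\<And>n. n \<in> S \<Longrightarrow> sg n = 1 \<or> sg n = -1"
    and m: "m \<in> S" "sg m = 1" "k x < k m"
  obtains n where "n \<in> S" "sg n = -1" "k x < k n" "k n < k m"
proof (rule ccontr)
  assume "\<not> thesis"
  with that have no: "n \<in> S \<Longrightarrow> k x < k n \<Longrightarrow> k n < k m \<Longrightarrow> sg n = 1" for n using sg by blast
  let ?B = "{n\<in>S. k x < k n \<and> k n \<le> k m}"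
  have B: "sg n = 1" if "n \<in> ?B" for n
    using that no m inj by (cases "k n = k m") (auto simp: inj_on_def order.order_iff_strict)
  have "sum sg {n\<in>S. k n \<le> k m} = sum sg ({n\<in>S. k n \<le> k x} \<union> ?B)"
    using m by (intro arg_cong[of _ _ "sum sg"]) auto
  moreover have "sum sg ({n\<in>S. k n \<le> k x} \<union> ?B) = sum sg {n\<in>S. k n \<le> k x} + sum sg ?B"
    by (rule sum.union_disjoint) (use fin in auto)
  moreover have "sum sg {n\<in>S. k n \<le> k m} \<le> sum sg {n\<in>S. k n \<le> k x}"
    using g downset_le[of k S "k m"] by (simp add: cogood_def)
  moreover have "sum sg ?B = int (card ?B)" using B by simp
  moreover have "card ?B > 0" using fin m by (auto simp: card_gt_0_iff)
  ultimately show False by linarith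
qed

text \<open>If only minuses stood between \<open>m\<close> and \<open>x\<close>, cutting the downset
  below \<open>x\<close> back to below \<open>m\<close> would increase its sum.\<close>

lemma good_below:
  assumes g: "good k sg S x" and fin: "finite S" and inj: "inj_on k S"
    and sg: "\<And>n. n \<in> S \<Longrightarrow> sg n = 1 \<or> sg n = -1"
    and m: "m \<in> S" "sg m = -1" "k m < k x"
  obtains n where "n \<in> S" "sg n = 1" "k m < k n" "k n < k x"
proof (rule ccontr)
  assume "\<not> thesis"
  with that have no: "n \<in> S \<Longrightarrow> k m < k n \<Longrightarrow> k n < k x \<Longrightarrow> sg n = -1" for n using sg by blast
  let ?B = "{n\<in>S. k m \<le> k n \<and> k n < k x}"
  have B: "sg n = -1" if "n \<in> ?B" for n
    using that no m inj by (cases "k n = k m") (auto simp: inj_on_def order.order_iff_strict)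
  have "sum sg {n\<in>S. k n < k x} = sum sg ({n\<in>S. k n < k m} \<union> ?B)"
    using m by (intro arg_cong[of _ _ "sum sg"]) auto
  moreover have "sum sg ({n\<in>S. k n < k m} \<union> ?B) = sum sg {n\<in>S. k n < k m} + sum sg ?B"
    using fin by (intro sum.union_disjoint) auto
  moreover have "sum sg {n\<in>S. k n < k m} \<le> sum sg {n\<in>S. k n < k x}"
    using g downset_less[of k S "k m"] by (simp add: good_def)
  moreover have "sum sg ?B = - int (card ?B)" using B by simp
  moreover have "card ?B > 0" using fin m by (auto simp: card_gt_0_iff)
  ultimately show False by linarith
qed

subsection \<open>The operators in terms of cogood nodes\<close>

definition signed_nodes :: "nat \<Rightarrow> int \<Rightarrow> node set \<Rightarrow> node set" where
  "signed_nodes e i Y = {n \<in> addable Y \<union> removable Y. residue e n = i mod int e}"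

definition node_sign :: "node set \<Rightarrow> node \<Rightarrow> int" where
  "node_sign Y n = (if n \<in> addable Y then 1 else -1)"

lemma node_sign_cases: "node_sign Y n = 1 \<or> node_sign Y n = -1"
  by (simp add: node_sign_def)

lemma ex1_sorted_desc:
  fixes k :: "'a \<Rightarrow> 'k::linorder"
  assumes fin: "finite S" and inj: "inj_on k S"
  shows "\<exists>!ns. distinct ns \<and> set ns = S \<and> sorted_wrt (\<lambda>a b. k b < k a) ns"
proof (rule ex_ex1I)
  define ns where "ns = rev (map (inv_into S k) (sorted_list_of_set (k ` S)))"
  have ks: "map k (rev ns) = sorted_list_of_set (k ` S)"
    unfolding ns_def using fin by (auto simp: f_inv_into_f intro!: map_idI)
  have 1: "distinct ns" using ks by (metis distinct_map distinct_rev distinct_sorted_list_of_set)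
  have "set ns = inv_into S k ` k ` S" unfolding ns_def using fin by simp
  then have 2: "set ns = S" using inj by simp
  have "sorted_wrt (<) (map k (rev ns))" unfolding ks by (rule strict_sorted_list_of_set)
  then have "sorted_wrt (\<lambda>a b. k b < k a) ns" by (simp add: sorted_wrt_map sorted_wrt_rev)
  with 1 2 show "\<exists>ns. distinct ns \<and> set ns = S \<and> sorted_wrt (\<lambda>a b. k b < k a) ns" by blast
next
  have *: "map k (rev ns) = sorted_list_of_set (k ` S)"
    if "distinct ns \<and> set ns = S \<and> sorted_wrt (\<lambda>a b. k b < k a) ns" for ns
  proof -
    have "sorted_wrt (<) (map k (rev ns))" using that by (simp add: sorted_wrt_map sorted_wrt_rev)
    moreover have "set (map k (rev ns)) = k ` S" using that by auto
    ultimately show ?thesis using fin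
      by (metis strict_sorted_equal strict_sorted_list_of_set set_sorted_list_of_set finite_imageI)
  qed
  fix ns ns'
  assume a: "distinct ns \<and> set ns = S \<and> sorted_wrt (\<lambda>a b. k b < k a) ns"
     "distinct ns' \<and> set ns' = S \<and> sorted_wrt (\<lambda>a b. k b < k a) ns'"
  then have "map k (rev ns) = map k (rev ns')" using * by simp
  then have "rev ns = rev ns'" by (rule map_inj_on) (use a inj in auto)
  then show "ns = ns'" by simp
qed

lemma downset_suffix:
  fixes k :: "'a \<Rightarrow> 'k::linorder"
  assumes "sorted_wrt (\<lambda>a b. k b < k a) ns" and D: "downset k (set ns) D"
  shows "\<exists>a b. ns = a @ b \<and> set b = D"
  using assms
proof (induction ns arbitrary: D)
  case Nil
  then show ?case by (simp add: downset_def)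
next
  case (Cons n ns)
  show ?case
  proof (cases "n \<in> D")
    case True
    have "m \<in> D" if "m \<in> set ns" for m
    proof -
      have "k m \<le> k n" using Cons.prems(1) that by (simp add: less_imp_le)
      then show ?thesis using Cons.prems(2) True that by (simp add: downset_def)
    qed
    then have "set (n # ns) = D" using Cons.prems(2) True by (auto simp: downset_def)
    then show ?thesis by (intro exI[of _ "[]"] exI[of _ "n # ns"]) simp
  next
    case False
    then have "downset k (set ns) D" using Cons.prems by (auto simp: downset_def)
    moreover have "sorted_wrt (\<lambda>a b. k b < k a) ns" using Cons.prems(1) by simp
    ultimately obtain a b where "ns = a @ b" "set b = D" using Cons.IH by blast
    then show ?thesis by (intro exI[of _ "n # a"] exI[of _ b]) simp
  qed
qed

text \<open>Replaces the definite descriptions inside \<open>f_op\<close> (the ordered list and the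
  reduced word) by an extremal condition on sums over downsets, which can be compared between
  different orders.\<close>

lemma f_op_eq_Some_iff:
  fixes k :: "node \<Rightarrow> 'k::linorder"
  assumes fin: "finite (signed_nodes e i Y)" and inj: "inj_on k (signed_nodes e i Y)"
    and prec: "\<And>a b. a \<in> signed_nodes e i Y \<Longrightarrow> b \<in> signed_nodes e i Y \<Longrightarrow> a \<noteq> b \<Longrightarrow>
        node_prec e A a b \<longleftrightarrow> k a < k b"
  shows "f_op e A i Y = Some Z \<longleftrightarrow>
     (\<exists>x. cogood k (node_sign Y) (signed_nodes e i Y) x \<and> Z = insert x Y)"
proof -
  let ?S = "signed_nodes e i Y" and ?sg = "node_sign Y"
  \<comment> \<open>\<open>node_prec\<close> agrees with the key only on distinct nodes; a distinct
    list never compares a node with itself.\<close>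
  have eq: "distinct ns \<and> set ns = ?S \<and> sorted_wrt (\<lambda>a b. node_prec e A b a) ns \<longleftrightarrow>
      distinct ns \<and> set ns = ?S \<and> sorted_wrt (\<lambda>a b. k b < k a) ns" for ns
  proof -
    have "sorted_wrt (\<lambda>a b. node_prec e A b a) ns \<longleftrightarrow> sorted_wrt (\<lambda>a b. k b < k a) ns"
      if "distinct ns" "set ns = ?S"
      unfolding sorted_wrt_iff_nth_less using that prec
      by (smt (verit) nth_eq_iff_index_eq nth_mem order.strict_trans less_irrefl_nat)
    then show ?thesis by blast
  qed
  define ns where "ns = (THE ns. distinct ns \<and> set ns = ?S \<and> sorted_wrt (\<lambda>a b. k b < k a) ns)"
  have ns: "distinct ns" "set ns = ?S" "sorted_wrt (\<lambda>a b. k b < k a) ns"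
    using theI'[OF ex1_sorted_desc[OF fin inj]] unfolding ns_def by blast+
  define tag where "tag = (\<lambda>n. (n \<in> addable Y, n))"
  have sig: "i_signature e A i Y = map tag ns"
    unfolding i_signature_def Let_def ns_def tag_def
    using eq by (simp add: signed_nodes_def)
  have val: "val (map tag b) = sum ?sg (set b)" if "distinct b" for b
    using that by (induction b) (auto simp: tag_def node_sign_def)
  show ?thesis
  proof (rule first_plus_cases[of "map tag ns"])
    fix n u v
    assume *: "find fst (sig_reduce (map tag ns)) = Some (True, n)" "map tag ns = u @ (True, n) # v"
      "\<And>a b. map tag ns = a @ b \<Longrightarrow> val b \<le> val ((True, n) # v)"
      "\<And>a b. v = a @ b \<Longrightarrow> val b < val ((True, n) # v)"
    then obtain u' v' where uv: "ns = u' @ n # v'" "u = map tag u'" "v = map tag v'" "n \<in> addable Y"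
      by (auto simp: map_eq_append_conv tag_def)
    have le: "{m\<in>?S. k m \<le> k n} = set (n # v')"
      using ns unfolding ns(2)[symmetric] uv(1) by (fastforce simp: sorted_wrt_append)
    have d: "distinct (n # v')" using ns(1) uv by auto
    have vn: "val ((True, n) # v) = sum ?sg {m\<in>?S. k m \<le> k n}"
      using val[OF d] uv unfolding le by (simp add: tag_def)
    have "cogood k ?sg ?S n"
      unfolding cogood_def
    proof (intro conjI allI impI)
      show "n \<in> ?S" using ns(2) uv(1) by auto
      show "?sg n = 1" using uv(4) by (simp add: node_sign_def)
      fix D assume D: "downset k ?S D"
      then obtain a b where ab: "ns = a @ b" "set b = D"
        using downset_suffix[OF ns(3)] ns(2) by metis
      have "distinct b" using ns(1) ab by auto
      then have b: "val (map tag b) = sum ?sg D" using val ab by simp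
      show "sum ?sg D \<le> sum ?sg {m\<in>?S. k m \<le> k n}"
        using *(3)[of "map tag a" "map tag b"] ab(1) b vn by simp
      assume "n \<notin> D"
      then have nb: "n \<notin> set b" using ab by simp
      obtain a' where "v' = a' @ b"
      proof -
        from ab(1) uv(1) have "u' @ n # v' = a @ b" by simp
        then consider us where "u' @ us = a" "n # v' = us @ b" | us where "u' = a @ us" "us @ n # v' = b"
          by (auto simp: append_eq_append_conv2)
        then show thesis
        proof cases
          case (1 us)
          then show thesis using nb that by (cases us) auto
        next
          case (2 us)
          then show thesis using nb by auto
        qed
      qed
      then show "sum ?sg D < sum ?sg {m\<in>?S. k m \<le> k n}"
        using *(4)[of "map tag a'" "map tag b"] uv(3) b vn by simp
    qed
    moreover have "f_op e A i Y = Some (insert n Y)" by (simp add: f_op_def sig *(1))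
    ultimately show ?thesis using cogood_unique[OF _ _ inj] by (metis option.inject)
  next
    assume *: "find fst (sig_reduce (map tag ns)) = None"
      "\<And>a b. map tag ns = a @ b \<Longrightarrow> val b \<le> 0"
    have "\<not> cogood k ?sg ?S x" for x
    proof
      assume "cogood k ?sg ?S x"
      then have "0 < sum ?sg {m\<in>?S. k m \<le> k x}"
        using downset_empty[of k ?S] by (force simp: cogood_def)
      moreover obtain a b where ab: "ns = a @ b" "set b = {m\<in>?S. k m \<le> k x}"
        using downset_suffix[OF ns(3)] downset_le[of k ?S] ns(2) by metis
      moreover have "distinct b" using ns(1) ab by auto
      ultimately show False using *(2)[of "map tag a" "map tag b"] val[of b] by simp
    qed
    moreover have "f_op e A i Y = None" by (simp add: f_op_def sig *(1))
    ultimately show ?thesis by simp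
  qed
qed

section \<open>Partitions\<close>

lemma is_partition_down:
  "is_partition Y \<Longrightarrow> (r,c) \<in> Y \<Longrightarrow> 1 \<le> r' \<Longrightarrow> r' \<le> r \<Longrightarrow> 1 \<le> c' \<Longrightarrow> c' \<le> c \<Longrightarrow> (r',c') \<in> Y"
  unfolding is_partition_def by blast

lemma is_partition_pos: "is_partition Y \<Longrightarrow> (r,c) \<in> Y \<Longrightarrow> 1 \<le> r \<and> 1 \<le> c"
  unfolding is_partition_def by blast

lemma is_partition_finite: "is_partition Y \<Longrightarrow> finite Y"
  unfolding is_partition_def by blast

lemma initial_segment_eq:
  fixes T :: "nat set"
  assumes "finite T" "\<And>c. c \<in> T \<Longrightarrow> 1 \<le> c" "\<And>c c'. c \<in> T \<Longrightarrow> 1 \<le> c' \<Longrightarrow> c' \<le> c \<Longrightarrow> c' \<in> T"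
  shows "T = {1..card T}"
proof (cases "T = {}")
  case False
  have "T = {1..Max T}"
  proof
    show "T \<subseteq> {1..Max T}" using assms(1,2) by auto
    show "{1..Max T} \<subseteq> T" using assms(3)[OF Max_in[OF assms(1) False]] by auto
  qed
  then show ?thesis by (metis card_atLeastAtMost diff_Suc_1)
qed simp

lemma mem_iff_row_len:
  assumes "is_partition Y"
  shows "(r,c) \<in> Y \<longleftrightarrow> 1 \<le> r \<and> 1 \<le> c \<and> c \<le> row_len Y r"
proof (cases "1 \<le> r")
  case True
  have "finite {c. (r,c) \<in> Y}"
    by (rule finite_subset[of _ "snd ` Y"]) (use is_partition_finite[OF assms] in force)+
  then have "{c. (r,c) \<in> Y} = {1..row_len Y r}"
    unfolding row_len_def
    by (rule initial_segment_eq) (use assms is_partition_pos is_partition_down True in \<open>blast+\<close>)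
  then show ?thesis using True by (metis (no_types, lifting) atLeastAtMost_iff mem_Collect_eq)
qed (use is_partition_pos[OF assms] in blast)

lemma mem_iff_col_len:
  assumes "is_partition Y"
  shows "(r,c) \<in> Y \<longleftrightarrow> 1 \<le> r \<and> 1 \<le> c \<and> r \<le> col_len Y c"
proof (cases "1 \<le> c")
  case True
  have "finite {r. (r,c) \<in> Y}"
    by (rule finite_subset[of _ "fst ` Y"]) (use is_partition_finite[OF assms] in force)+
  then have "{r. (r,c) \<in> Y} = {1..col_len Y c}"
    unfolding col_len_def
    by (rule initial_segment_eq) (use assms is_partition_pos is_partition_down True in \<open>blast+\<close>)
  then show ?thesis using True by (metis (no_types, lifting) atLeastAtMost_iff mem_Collect_eq)
qed (use is_partition_pos[OF assms] in blast)

lemma row_len_eqI: "is_partition Y \<Longrightarrow> (r,c) \<in> Y \<Longrightarrow> (r,Suc c) \<notin> Y \<Longrightarrow> row_len Y r = c"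
  using mem_iff_row_len[of Y r c] mem_iff_row_len[of Y r "Suc c"] by simp

lemma col_len_eqI: "is_partition Y \<Longrightarrow> (r,c) \<in> Y \<Longrightarrow> (Suc r,c) \<notin> Y \<Longrightarrow> col_len Y c = r"
  using mem_iff_col_len[of Y r c] mem_iff_col_len[of Y "Suc r" c] by simp

lemma addable_iff:
  assumes Y: "is_partition Y"
  shows "(r,c) \<in> addable Y \<longleftrightarrow> 1 \<le> r \<and> 1 \<le> c \<and> (r,c) \<notin> Y \<and>
     (r = 1 \<or> (r-1,c) \<in> Y) \<and> (c = 1 \<or> (r,c-1) \<in> Y)" (is "?L \<longleftrightarrow> ?R")
proof
  assume L: ?L
  then have p: "is_partition (insert (r,c) Y)" and 1: "1 \<le> r" "1 \<le> c" "(r,c) \<notin> Y"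
    by (auto simp: addable_def)
  have "(r-1,c) \<in> insert (r,c) Y" if "r \<noteq> 1" using is_partition_down[OF p, of r c "r-1" c] 1 that by auto
  then have "r = 1 \<or> (r-1,c) \<in> Y" using 1 by (cases r) auto
  moreover have "(r,c-1) \<in> insert (r,c) Y" if "c \<noteq> 1" using is_partition_down[OF p, of r c r "c-1"] 1 that by auto
  then have "c = 1 \<or> (r,c-1) \<in> Y" using 1 by (cases c) auto
  ultimately show ?R using 1 by blast
next
  assume R: ?R
  have "(r',c') \<in> insert (r,c) Y"
    if le: "(a,b) \<in> insert (r,c) Y" "1 \<le> r'" "r' \<le> a" "1 \<le> c'" "c' \<le> b" for a b r' c'
  proof (cases "(a,b) \<in> Y")
    case True
    then show ?thesis using is_partition_down[OF Y] that by blast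
  next
    case False
    with that have ab: "a = r" "b = c" by auto
    consider "r' = r" "c' = c" | "r' \<le> r - 1" "r \<noteq> 1" | "c' \<le> c - 1" "c \<noteq> 1"
      using le ab by linarith
    then show ?thesis
    proof cases
      case 2
      then show ?thesis using is_partition_down[OF Y, of "r-1" c r' c'] R le ab by auto
    next
      case 3
      then show ?thesis using is_partition_down[OF Y, of r "c-1" r' c'] R le ab by auto
    qed simp
  qed
  moreover have "\<forall>(a,b)\<in>insert (r,c) Y. 1 \<le> a \<and> 1 \<le> b" using R is_partition_pos[OF Y] by auto
  ultimately have "is_partition (insert (r,c) Y)"
    using is_partition_finite[OF Y] unfolding is_partition_def by blast
  with R show ?L by (simp add: addable_def)
qed

lemma removable_iff:
  assumes Y: "is_partition Y"
  shows "(r,c) \<in> removable Y \<longleftrightarrow> (r,c) \<in> Y \<and> (Suc r,c) \<notin> Y \<and> (r,Suc c) \<notin> Y" (is "?L \<longleftrightarrow> ?R")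
proof
  assume L: ?L
  then have p: "is_partition (Y - {(r,c)})" and 1: "(r,c) \<in> Y" by (auto simp: removable_def)
  have "1 \<le> r" "1 \<le> c" using is_partition_pos[OF Y 1] by auto
  then show ?R using 1 is_partition_down[OF p, of "Suc r" c r c] is_partition_down[OF p, of r "Suc c" r c]
    by auto
next
  assume R: ?R
  have "(r',c') \<in> Y - {(r,c)}"
    if "(a,b) \<in> Y - {(r,c)}" "1 \<le> r'" "r' \<le> a" "1 \<le> c'" "c' \<le> b" for a b r' c'
  proof -
    have "(r',c') \<in> Y" using is_partition_down[OF Y] that by blast
    moreover have "(r',c') \<noteq> (r,c)"
    proof
      assume "(r',c') = (r,c)"
      with that have "Suc r \<le> a \<or> Suc c \<le> b" by auto
      then show False
        using is_partition_down[OF Y, of a b "Suc r" c] is_partition_down[OF Y, of a b r "Suc c"]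
          that R \<open>(r',c') = (r,c)\<close> by auto
    qed
    ultimately show ?thesis by blast
  qed
  moreover have "\<forall>(a,b)\<in>Y - {(r,c)}. 1 \<le> a \<and> 1 \<le> b" using is_partition_pos[OF Y] by auto
  ultimately have "is_partition (Y - {(r,c)})"
    using is_partition_finite[OF Y] unfolding is_partition_def by blast
  with R show ?L by (simp add: removable_def)
qed

lemma addable_insert_removable: "x \<in> addable Y \<Longrightarrow> is_partition (insert x Y) \<and> x \<notin> Y"
  by (cases x) (auto simp: addable_def)

lemma removable_mem: "x \<in> removable Y \<Longrightarrow> is_partition (Y - {x}) \<and> x \<in> Y"
  by (auto simp: removable_def)

lemma removable_imp_addable:
  assumes "is_partition Y" "x \<in> removable Y"
  shows "x \<in> addable (Y - {x})"
proof -
  obtain r c where x: "x = (r,c)" by (cases x)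
  have "x \<in> Y" using removable_mem[OF assms(2)] by blast
  then have "insert x (Y - {x}) = Y" by blast
  then show ?thesis using assms(1) is_partition_pos[OF assms(1)] \<open>x \<in> Y\<close>
    unfolding x addable_def by simp
qed

lemma addable_row_len:
  assumes "is_partition Y" "(r,c) \<in> addable Y"
  shows "Suc (row_len Y r) = c"
  using assms(2) mem_iff_row_len[OF assms(1), of r c] mem_iff_row_len[OF assms(1), of r "c-1"]
  unfolding addable_iff[OF assms(1)] by auto

lemma addable_col_len:
  assumes "is_partition Y" "(r,c) \<in> addable Y"
  shows "Suc (col_len Y c) = r"
  using assms(2) mem_iff_col_len[OF assms(1), of r c] mem_iff_col_len[OF assms(1), of "r-1" c]
  unfolding addable_iff[OF assms(1)] by auto

lemma removable_row_len:
  assumes "is_partition Y" "(r,c) \<in> removable Y"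
  shows "row_len Y r = c"
  using assms row_len_eqI by (simp add: removable_iff)

lemma removable_col_len:
  assumes "is_partition Y" "(r,c) \<in> removable Y"
  shows "col_len Y c = r"
  using assms col_len_eqI by (simp add: removable_iff)

lemma row_len_insert_other: "r \<noteq> fst x \<Longrightarrow> row_len (insert x Y) r = row_len Y r"
  unfolding row_len_def by (rule arg_cong[of _ _ card]) auto

lemma col_len_insert_other: "c \<noteq> snd x \<Longrightarrow> col_len (insert x Y) c = col_len Y c"
  unfolding col_len_def by (rule arg_cong[of _ _ card]) auto

lemma removable_insert:
  assumes "is_partition Y" "x \<in> addable Y"
  shows "x \<in> removable (insert x Y)"
  using assms addable_insert_removable[OF assms(2)] by (simp add: removable_def)

lemma row_len_insert_same:
  assumes "is_partition Y" "(r,c) \<in> addable Y"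
  shows "row_len (insert (r,c) Y) r = c"
  using removable_row_len[OF _ removable_insert[OF assms]] addable_insert_removable[OF assms(2)] by blast

lemma col_len_insert_same:
  assumes "is_partition Y" "(r,c) \<in> addable Y"
  shows "col_len (insert (r,c) Y) c = r"
  using removable_col_len[OF _ removable_insert[OF assms]] addable_insert_removable[OF assms(2)] by blast

section \<open>Signed nodes of a fixed residue\<close>

lemma finite_addable:
  assumes "is_partition Y"
  shows "finite (addable Y)"
proof (rule finite_subset)
  show "addable Y \<subseteq> insert (1,1) ((\<lambda>(r,c). (Suc r,c)) ` Y \<union> (\<lambda>(r,c). (r,Suc c)) ` Y)"
  proof
    fix x assume "x \<in> addable Y"
    moreover obtain r c where "x = (r,c)" by (cases x)
    ultimately show "x \<in> insert (1,1) ((\<lambda>(r,c). (Suc r,c)) ` Y \<union> (\<lambda>(r,c). (r,Suc c)) ` Y)"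
      using addable_iff[OF assms, of r c] by (force simp: image_iff)
  qed
qed (use is_partition_finite[OF assms] in auto)

lemma finite_signed_nodes:
  assumes "is_partition Y"
  shows "finite (signed_nodes e i Y)"
proof (rule finite_subset)
  show "signed_nodes e i Y \<subseteq> addable Y \<union> Y" by (auto simp: signed_nodes_def removable_def)
qed (use assms finite_addable is_partition_finite in auto)

lemma mem_signed_nodes:
  assumes "n \<in> signed_nodes e i Y"
  shows "node_sign Y n = 1 \<Longrightarrow> n \<in> addable Y" "node_sign Y n = -1 \<Longrightarrow> n \<in> removable Y"
    "residue e n = i mod int e"
  using assms by (auto simp: signed_nodes_def node_sign_def split: if_splits)

lemma addable_sign: "n \<in> addable Y \<Longrightarrow> node_sign Y n = 1"
  by (simp add: node_sign_def)

lemma removable_sign: "n \<in> removable Y \<Longrightarrow> node_sign Y n = -1"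
  using addable_insert_removable[of n Y] removable_mem[of n Y] by (auto simp: node_sign_def)

lemma residue_eq_iff:
  "residue e (a,b) = residue e (c,d) \<longleftrightarrow> int e dvd (int b - int a) - (int d - int c)"
  by (simp add: residue_def mod_eq_dvd_iff)

lemma residue_neighbours:
  assumes "2 \<le> e"
  shows "residue e (Suc r,c) \<noteq> residue e (r,c)" "residue e (r,Suc c) \<noteq> residue e (r,c)"
  using assms zdvd_imp_le[of "int e" 1] by (auto simp: residue_eq_iff algebra_simps)

text \<open>Addability and removability of a node depend only on it and its edge neighbours, whose
  residues differ from its own; so among nodes of residue \<open>i\<close> only \<open>x\<close>
  changes status.\<close>

lemma signed_nodes_remove:
  assumes Y: "is_partition Y" and e: "2 \<le> e" and x: "x \<in> removable Y" "residue e x = i mod int e"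
  shows "signed_nodes e i (Y - {x}) = signed_nodes e i Y"
    "\<And>n. n \<in> signed_nodes e i Y \<Longrightarrow> n \<noteq> x \<Longrightarrow> node_sign (Y - {x}) n = node_sign Y n"
proof -
  have Y': "is_partition (Y - {x})" using removable_mem x by blast
  have a: "n \<in> addable (Y - {x}) \<longleftrightarrow> n \<in> addable Y" 
    if n: "residue e n = i mod int e" "n \<noteq> x" for n
  proof -
    obtain r c where rc: "n = (r,c)" by (cases n)
    have "(r-1,c) \<noteq> x" if "1 \<le> r" using residue_neighbours(1)[OF e, of "r-1" c] n rc x(2) that by auto
    moreover have "(r,c-1) \<noteq> x" if "1 \<le> c"
      using residue_neighbours(2)[OF e, of r "c-1"] n rc x(2) that by auto
    ultimately show ?thesis using n(2) unfolding rc addable_iff[OF Y] addable_iff[OF Y'] by auto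
  qed
  have b: "n \<in> removable (Y - {x}) \<longleftrightarrow> n \<in> removable Y"
    if n: "residue e n = i mod int e" "n \<noteq> x" for n
  proof -
    obtain r c where rc: "n = (r,c)" by (cases n)
    have "(Suc r,c) \<noteq> x" using residue_neighbours(1)[OF e, of r c] n rc x(2) by auto
    moreover have "(r,Suc c) \<noteq> x" using residue_neighbours(2)[OF e, of r c] n rc x(2) by auto
    ultimately show ?thesis using n(2) unfolding rc removable_iff[OF Y] removable_iff[OF Y'] by auto
  qed
  show "signed_nodes e i (Y - {x}) = signed_nodes e i Y"
    using a b x removable_imp_addable[OF Y x(1)] unfolding signed_nodes_def by blast
  show "node_sign (Y - {x}) n = node_sign Y n" if "n \<in> signed_nodes e i Y" "n \<noteq> x" for n
    using a[of n] that by (simp add: node_sign_def signed_nodes_def)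
qed

section \<open>Regular partitions for a translation-invariant order\<close>

text \<open>Equality of the two residues says that \<open>e\<close> divides the hook length.
  Phrasing the forbidden arm by comparisons of nodes lets one argument serve every order and every
  modulus.\<close>

definition key_regular :: "nat \<Rightarrow> (node \<Rightarrow> 'k::linorder) \<Rightarrow> node set \<Rightarrow> bool" where
  "key_regular e k Y \<longleftrightarrow> is_partition Y \<and>
     (\<forall>r d. (r,d) \<in> Y \<longrightarrow> residue e (Suc (col_len Y d), d) = residue e (r, row_len Y r) \<longrightarrow>
        k (r, row_len Y r) < k (Suc (col_len Y d), d) \<longrightarrow>
        \<not> k (Suc (col_len Y d), d) < k (Suc r, Suc (row_len Y r)))"

text \<open>A key linear in row and column is preserved in comparisons when both nodes are shifted
  alike, which is what moves a hook to its neighbour. A general ordered ring leaves room for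
  infinitesimal tie-breaks.\<close>

locale node_order =
  fixes e :: nat and R C :: "'k::linordered_idom"
  assumes e3: "3 \<le> e" and R_pos: "0 < R" and C_pos: "0 < C"
    and indep: "\<And>a b a' b'. R * of_nat a + C * of_nat b = R * of_nat a' + C * of_nat b' \<Longrightarrow>
      a = a' \<and> b = b'"
begin

definition key :: "node \<Rightarrow> 'k" where
  "key n = R * of_nat (fst n) + C * of_nat (snd n)"

lemma key_Suc: "key (Suc r, c) = key (r,c) + R" "key (r, Suc c) = key (r,c) + C"
  by (simp_all add: key_def algebra_simps)

lemma key_inj: "key m = key n \<Longrightarrow> m = n"
  using indep[of "fst m" "snd m" "fst n" "snd n"] by (simp add: key_def prod_eq_iff)

lemma key_inj_on: "inj_on key S"
  by (rule inj_onI) (rule key_inj)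

lemma key_minus_row: "1 \<le> r \<Longrightarrow> key (r - 1, c) = key (r,c) - R"
  using key_Suc(1)[of "r-1" c] by simp

lemma key_minus_col: "1 \<le> c \<Longrightarrow> key (r, c - 1) = key (r,c) - C"
  using key_Suc(2)[of r "c-1"] by simp

lemma regularD:
  assumes "key_regular e key Y" "(r,d) \<in> Y"
    "int e dvd (int d - int (Suc (col_len Y d))) - (int (row_len Y r) - int r)"
    "key (r, row_len Y r) < key (Suc (col_len Y d), d)"
  shows "key (r, row_len Y r) + R + C \<le> key (Suc (col_len Y d), d)"
proof -
  have "\<not> key (Suc (col_len Y d), d) < key (Suc r, Suc (row_len Y r))"
    using assms unfolding key_regular_def residue_eq_iff by blast
  then show ?thesis by (simp add: key_Suc not_less add_ac)
qed

text \<open>A removable and an addable node span a hook: with \<open>n\<close> as hand and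
  \<open>m\<close> just below the foot if \<open>m\<close> lies weakly left of \<open>n\<close>, and
  otherwise with \<open>m\<close> just right of the hand and \<open>n\<close> as foot.\<close>

lemma addable_separated:
  assumes reg: "key_regular e key Y" and m: "m \<in> addable Y" and n: "n \<in> removable Y"
    and res: "residue e m = residue e n" and lt: "key n < key m"
  shows "key n + R + C \<le> key m"
proof -
  have Y: "is_partition Y" using reg by (simp add: key_regular_def)
  obtain s d where sd: "m = (s,d)" by (cases m)
  obtain r c where rc: "n = (r,c)" by (cases n)
  have m': "(s,d) \<notin> Y" "1 \<le> s" "1 \<le> d" "s = 1 \<or> (s-1,d) \<in> Y" "d = 1 \<or> (s,d-1) \<in> Y"
    using m sd addable_iff[OF Y] by auto
  have n': "(r,c) \<in> Y" "(Suc r,c) \<notin> Y" "(r,Suc c) \<notin> Y" using n rc removable_iff[OF Y] by auto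
  have rc1: "1 \<le> r" "1 \<le> c" using is_partition_pos[OF Y n'(1)] by auto
  note lens = addable_row_len[OF Y m[unfolded sd]] addable_col_len[OF Y m[unfolded sd]]
    removable_row_len[OF Y n[unfolded rc]] removable_col_len[OF Y n[unfolded rc]]
  have dvd: "int e dvd (int d - int s) - (int c - int r)" using res sd rc residue_eq_iff by simp
  show ?thesis
  proof (cases "d \<le> c")
    case True
    then have "(r,d) \<in> Y" using is_partition_down[OF Y n'(1)] rc1 m' by blast
    from regularD[OF reg this] show ?thesis using lens dvd lt sd rc by simp
  next
    case False
    have "s \<le> r"
    proof (rule ccontr)
      assume "\<not> s \<le> r"
      moreover have "(s,d-1) \<in> Y" using m' False rc1 by auto
      moreover have "c \<le> d - 1" using False by linarith
      ultimately show False using is_partition_down[OF Y, of s "d-1" "Suc r" c] rc1 n' by simp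
    qed
    \<comment> \<open>At the hook of \<open>(s,c)\<close> the hand has key \<open>key m - C\<close>
      and the node below the foot has key \<open>key n + R\<close>. Were the first smaller,
      regularity would give \<open>key m <= key n\<close>, a contradiction; the reverse inequality
      is the claim.\<close>
    then have "(s,c) \<in> Y" using is_partition_down[OF Y n'(1), of s c] rc1 m' by simp
    moreover have "int e dvd (int c - int (Suc (col_len Y c))) - (int (row_len Y s) - int s)"
    proof -
      have "(int c - int (Suc (col_len Y c))) - (int (row_len Y s) - int s)
          = - ((int d - int s) - (int c - int r))" using lens by auto
      then show ?thesis using dvd by (metis dvd_minus_iff)
    qed
    moreover have "key (s, row_len Y s) = key m - C"
      using lens(1) key_Suc(2)[of s "row_len Y s"] sd by simp
    moreover have "key (Suc (col_len Y c), c) = key n + R" using lens(4) key_Suc(1) rc by simp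
    ultimately show ?thesis using regularD[OF reg, of s c] lt R_pos C_pos
      by (cases "key m - C < key n + R") (auto simp: algebra_simps)
  qed
qed

text \<open>Some removable node lies between \<open>x\<close> and \<open>m\<close>, and that node is
  already a full diagonal step below \<open>m\<close>.\<close>

lemma cogood_gap:
  assumes reg: "key_regular e key Y" and g: "cogood key (node_sign Y) (signed_nodes e i Y) x"
    and m: "m \<in> addable Y" "residue e m = residue e x" "key x < key m"
  shows "key x + R + C \<le> key m"
proof -
  have Y: "is_partition Y" using reg by (simp add: key_regular_def)
  have x: "x \<in> signed_nodes e i Y" using g by (simp add: cogood_def)
  have mS: "m \<in> signed_nodes e i Y" using x m by (simp add: signed_nodes_def)
  obtain n where n: "n \<in> signed_nodes e i Y" "node_sign Y n = -1" "key x < key n" "key n < key m"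
    using cogood_above[OF g finite_signed_nodes[OF Y] key_inj_on node_sign_cases mS addable_sign[OF m(1)] m(3)]
    by blast
  have "key n + R + C \<le> key m"
    using addable_separated[OF reg m(1) mem_signed_nodes(2)[OF n(1,2)] _ n(4)]
      mem_signed_nodes(3)[OF n(1)] mem_signed_nodes(3)[OF mS] by simp
  then show ?thesis using n(3) by simp
qed

lemma good_gap:
  assumes reg: "key_regular e key Y" and g: "good key (node_sign Y) (signed_nodes e i Y) x"
    and m: "m \<in> removable Y" "residue e m = residue e x" "key m < key x"
  shows "key m + R + C \<le> key x"
proof -
  have Y: "is_partition Y" using reg by (simp add: key_regular_def)
  have x: "x \<in> signed_nodes e i Y" using g by (simp add: good_def)
  have mS: "m \<in> signed_nodes e i Y" using x m by (simp add: signed_nodes_def)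
  obtain n where n: "n \<in> signed_nodes e i Y" "node_sign Y n = 1" "key m < key n" "key n < key x"
    using good_below[OF g finite_signed_nodes[OF Y] key_inj_on node_sign_cases mS removable_sign[OF m(1)] m(3)]
    by blast
  have "key m + R + C \<le> key n"
    using addable_separated[OF reg mem_signed_nodes(1)[OF n(1,2)] m(1) _ n(3)]
      mem_signed_nodes(3)[OF n(1)] mem_signed_nodes(3)[OF mS] by simp
  then show ?thesis using n(4) by simp
qed

lemma residue_eqI:
  "int e dvd (int b - int a) - (int d - int c) \<Longrightarrow> residue e (a,b) = residue e (c,d)"
  by (simp add: residue_eq_iff)

text \<open>A forbidden hook created by adding \<open>x\<close> points either at an addable node too close above \<open>x\<close>
  or, shifted by one row or column, at a forbidden hook already present.\<close>
lemma key_regular_insert: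
  assumes reg: "key_regular e key Y" and g: "cogood key (node_sign Y) (signed_nodes e i Y) x"
  shows "key_regular e key (insert x Y)"
proof -
  have Y: "is_partition Y" using reg by (simp add: key_regular_def)
  have x: "x \<in> addable Y" using g mem_signed_nodes(1)[of x e i Y] by (simp add: cogood_def)
  have Y': "is_partition (insert x Y)" using addable_insert_removable x by blast
  obtain r0 c0 where x0: "x = (r0,c0)" by (cases x)
  note xa = x[unfolded x0]
  have x1: "1 \<le> r0" "1 \<le> c0" "(r0,c0) \<notin> Y" using xa addable_iff[OF Y] by auto
  have lens: "Suc (row_len Y r0) = c0" "Suc (col_len Y c0) = r0"
      "row_len (insert x Y) r0 = c0" "col_len (insert x Y) c0 = r0"
    using addable_row_len[OF Y xa] addable_col_len[OF Y xa] row_len_insert_same[OF Y xa]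
      col_len_insert_same[OF Y xa] x0 by auto
  have "key (r, row_len (insert x Y) r) + R + C \<le> key (Suc (col_len (insert x Y) d), d)"
    if rd: "(r,d) \<in> insert x Y"
      and dvd: "int e dvd (int d - int (Suc (col_len (insert x Y) d))) - (int (row_len (insert x Y) r) - int r)"
      and lt: "key (r, row_len (insert x Y) r) < key (Suc (col_len (insert x Y) d), d)" for r d
  proof -
    consider "r = r0" "d = c0" | "r = r0" "d \<noteq> c0" | "r \<noteq> r0" "d = c0" | "r \<noteq> r0" "d \<noteq> c0" by blast
    then show ?thesis
    proof cases
      case 1
      \<comment> \<open>The hook at the new node has length 1.\<close>
      then have "int e dvd -1" using dvd lens by (simp add: algebra_simps)
      then show ?thesis using e3 by simp
    next
      case 2
      then have rdY: "(r0,d) \<in> Y" using rd x0 by auto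
      have d: "1 \<le> d" "d < c0" "1 \<le> r0"
        using mem_iff_row_len[OF Y, of r0 d] rdY lens by auto
      define s where "s = col_len Y d"
      have s: "col_len (insert x Y) d = s" using 2 x0 by (simp add: s_def col_len_insert_other)
      have sd: "(s,d) \<in> Y" "(Suc s,d) \<notin> Y" "r0 \<le> s"
        using mem_iff_col_len[OF Y, of s d] mem_iff_col_len[OF Y, of "Suc s" d]
          mem_iff_col_len[OF Y, of r0 d] rdY by (auto simp: s_def)
      have lt': "key x < key (Suc s,d)" using lt 2 lens s x0 by simp
      have dvd': "int e dvd (int d - int (Suc s)) - (int c0 - int r0)" using dvd 2 lens s by simp
      \<comment> \<open>Here \<open>x\<close> is the hand. Either the node below the foot is
        addable, so \<open>cogood_gap\<close> applies, or column \<open>d - 1\<close> is as long as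
        column \<open>d\<close> and the hook shifts left to one of \<open>Y\<close>.\<close>
      show ?thesis
      proof (cases "d = 1 \<or> (Suc s,d-1) \<in> Y")
        case True
        then have "(Suc s,d) \<in> addable Y" using sd d addable_iff[OF Y, of "Suc s" d] by auto
        then show ?thesis using cogood_gap[OF reg g _ _ lt'] residue_eqI[OF dvd'] x0 2 lens s by simp
      next
        case False
        then have d2: "1 \<le> d - 1" using d by auto
        have "(s,d-1) \<in> Y" using is_partition_down[OF Y sd(1)] d2 d sd by auto
        then have c: "col_len Y (d-1) = s" using False col_len_eqI[OF Y] by blast
        have "(r0,d-1) \<in> Y" using is_partition_down[OF Y rdY] d2 d by auto
        moreover have "int e dvd (int (d-1) - int (Suc s)) - (int (row_len Y r0) - int r0)"
          using dvd' lens(1) d by (auto simp: algebra_simps)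
        moreover have "key (Suc s, d-1) = key (Suc s,d) - C" using key_minus_col d by blast
        moreover have "key (r0, row_len Y r0) = key x - C"
          using key_Suc(2)[of r0 "row_len Y r0"] lens(1) x0 by simp
        ultimately have "key x - C + R + C \<le> key (Suc s,d) - C"
          using regularD[OF reg, of r0 "d-1"] lt' c by simp
        then show ?thesis using 2 s lens x0 C_pos by (simp add: algebra_simps)
      qed
    next
      case 3
      then have rdY: "(r,c0) \<in> Y" using rd x0 by auto
      have r: "1 \<le> r" "r < r0" "1 \<le> c0"
        using mem_iff_col_len[OF Y, of r c0] rdY lens by auto
      define c where "c = row_len Y r"
      have c: "row_len (insert x Y) r = c" using 3 x0 by (simp add: c_def row_len_insert_other)
      have sd: "(r,c) \<in> Y" "(r,Suc c) \<notin> Y" "c0 \<le> c"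
        using mem_iff_row_len[OF Y, of r c] mem_iff_row_len[OF Y, of r "Suc c"]
          mem_iff_row_len[OF Y, of r c0] rdY by (auto simp: c_def)
      have lt0: "key (r,c) < key x + R" using lt 3 lens c x0 key_Suc(1)[of r0 c0] by simp
      have dvd': "int e dvd (int c0 - int (Suc r0)) - (int c - int r)" using dvd 3 lens c by simp
      have goal: ?thesis if "key (r,c) + R + C \<le> key x + R"
        using that 3 lens c x0 key_Suc(1)[of r0 c0] by simp
      \<comment> \<open>Here \<open>x\<close> is the foot. Either the node right of the hand is
        addable and the gap above \<open>x\<close> keeps it from being too close, or row
        \<open>r - 1\<close> is as long as row \<open>r\<close> and the hook shifts up to one of
        \<open>Y\<close>.\<close>
      show ?thesis
      proof (cases "r = 1 \<or> (r-1,Suc c) \<in> Y")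
        case True
        then have a: "(r,Suc c) \<in> addable Y" using sd r addable_iff[OF Y, of r "Suc c"] by auto
        have "residue e (r,Suc c) = residue e x" unfolding x0
        proof (rule residue_eqI)
          have "(int (Suc c) - int r) - (int c0 - int r0) = - ((int c0 - int (Suc r0)) - (int c - int r))"
            by simp
          then show "int e dvd (int (Suc c) - int r) - (int c0 - int r0)" using dvd' dvd_minus_iff by metis
        qed
        with cogood_gap[OF reg g a] have "key x < key (r,c) + C \<Longrightarrow> key x + R + C \<le> key (r,c) + C"
          by (simp add: key_Suc)
        then have "\<not> key x < key (r,c) + C" using lt0 by auto
        then show ?thesis by (intro goal) (simp add: algebra_simps)
      next
        case False
        then have r2: "1 \<le> r - 1" using r by auto
        have "(r-1,c) \<in> Y" using is_partition_down[OF Y sd(1)] r2 r sd by auto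
        then have c': "row_len Y (r-1) = c" using False row_len_eqI[OF Y] by blast
        have "(r-1,c0) \<in> Y" using is_partition_down[OF Y rdY] r2 r by auto
        moreover have "int e dvd (int c0 - int (Suc (col_len Y c0))) - (int c - int (r - 1))"
          using dvd' lens(2) r by (auto simp: algebra_simps)
        moreover have "key (r-1, c) = key (r,c) - R" using key_minus_row r by blast
        ultimately have "key (r,c) - R + R + C \<le> key x"
          using regularD[OF reg, of "r-1" c0] lt0 c' lens(2) x0 by simp
        then show ?thesis by (intro goal) (simp add: algebra_simps)
      qed
    next
      case 4
      then have "row_len (insert x Y) r = row_len Y r" "col_len (insert x Y) d = col_len Y d"
        using x0 by (auto simp: row_len_insert_other col_len_insert_other)
      then show ?thesis using regularD[OF reg, of r d] rd dvd lt 4 x0 by auto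
    qed
  qed
  then show ?thesis
    unfolding key_regular_def residue_eq_iff using Y' by (auto simp: key_Suc not_less algebra_simps)
qed

text \<open>Dual to insertion: a forbidden hook of the smaller partition has a foot or hand that is
  removable and too close below \<open>x\<close>, or else shifts right or down to a forbidden hook
  of \<open>Y\<close>.\<close>

lemma key_regular_remove:
  assumes reg: "key_regular e key Y" and g: "good key (node_sign Y) (signed_nodes e i Y) x"
  shows "key_regular e key (Y - {x})"
proof -
  have Y: "is_partition Y" using reg by (simp add: key_regular_def)
  have x: "x \<in> removable Y" using g mem_signed_nodes(2)[of x e i Y] by (simp add: good_def)
  have Y': "is_partition (Y - {x})" using removable_mem x by blast
  obtain r0 c0 where x0: "x = (r0,c0)" by (cases x)
  note xa = x[unfolded x0]
  have ad: "(r0,c0) \<in> addable (Y - {x})" using removable_imp_addable[OF Y x] x0 by simp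
  have ins: "insert x (Y - {x}) = Y" using removable_mem x by blast
  have x1: "1 \<le> r0" "1 \<le> c0" "(r0,c0) \<in> Y"
    using is_partition_pos[OF Y, of r0 c0] removable_mem x x0 by auto
  have lens: "row_len Y r0 = c0" "col_len Y c0 = r0"
      "Suc (row_len (Y - {x}) r0) = c0" "Suc (col_len (Y - {x}) c0) = r0"
    using removable_row_len[OF Y xa] removable_col_len[OF Y xa] addable_row_len[OF Y' ad]
      addable_col_len[OF Y' ad] by auto
  have other: "row_len (Y - {x}) r = row_len Y r" if "r \<noteq> r0" for r
    using row_len_insert_other[of r x "Y - {x}"] that x0 ins by simp
  have other': "col_len (Y - {x}) d = col_len Y d" if "d \<noteq> c0" for d
    using col_len_insert_other[of d x "Y - {x}"] that x0 ins by simp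
  have "key (r, row_len (Y - {x}) r) + R + C \<le> key (Suc (col_len (Y - {x}) d), d)"
    if rd: "(r,d) \<in> Y - {x}"
      and dvd: "int e dvd (int d - int (Suc (col_len (Y - {x}) d))) - (int (row_len (Y - {x}) r) - int r)"
      and lt: "key (r, row_len (Y - {x}) r) < key (Suc (col_len (Y - {x}) d), d)" for r d
  proof -
    consider "r = r0" "d \<noteq> c0" | "r \<noteq> r0" "d = c0" | "r \<noteq> r0" "d \<noteq> c0" using rd x0 by blast
    then show ?thesis
    proof cases
      case 1
      then have rdY: "(r0,d) \<in> Y" using rd by auto
      have d: "1 \<le> d" "d < c0" using mem_iff_row_len[OF Y, of r0 d] rdY lens 1 by auto
      define s where "s = col_len Y d"
      have s: "col_len (Y - {x}) d = s" using 1 other' by (simp add: s_def)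
      have sd: "(s,d) \<in> Y" "(Suc s,d) \<notin> Y" "r0 \<le> s"
        using mem_iff_col_len[OF Y, of s d] mem_iff_col_len[OF Y, of "Suc s" d]
          mem_iff_col_len[OF Y, of r0 d] rdY by (auto simp: s_def)
      have kx: "key (r0, row_len (Y - {x}) r0) = key x - C"
        using key_Suc(2)[of r0 "row_len (Y - {x}) r0"] lens(3) x0 by simp
      have lt0: "key x - C < key (s,d) + R" using lt 1 s kx key_Suc(1) by simp
      have goal: ?thesis if "key x + R \<le> key (s,d) + R" using that 1 s kx by (simp add: key_Suc algebra_simps)
      have dvd': "int e dvd (int d - int s) - (int c0 - int r0)"
      proof -
        have "(int d - int (Suc s)) - (int (row_len (Y - {x}) r0) - int r0) = (int d - int s) - (int c0 - int r0)"
          using lens(3) by simp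
        then show ?thesis using dvd 1 s by metis
      qed
      show ?thesis
      proof (cases "(s,Suc d) \<in> Y")
        case False
        then have a: "(s,d) \<in> removable Y" using sd removable_iff[OF Y] by blast
        have "residue e (s,d) = residue e x" unfolding x0 using dvd' by (rule residue_eqI)
        with good_gap[OF reg g a] have "\<not> key (s,d) < key x" using lt0 by auto
        then show ?thesis by (intro goal) simp
      next
        case True
        have "(Suc s,Suc d) \<notin> Y" using is_partition_down[OF Y, of "Suc s" "Suc d" "Suc s" d] sd d by auto
        then have c: "col_len Y (Suc d) = s" using True col_len_eqI[OF Y] by blast
        have "(r0,Suc d) \<in> Y" using is_partition_down[OF Y x1(3)] d x1 by auto
        moreover have "int e dvd (int (Suc d) - int (Suc s)) - (int c0 - int r0)" using dvd' by simp
        moreover have "key (Suc s, Suc d) = key (s,d) + R + C" using key_Suc by simp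
        ultimately have "key x + R + C \<le> key (s,d) + R + C"
          using regularD[OF reg, of r0 "Suc d"] lt0 c lens(1) x0 by (simp add: algebra_simps)
        then show ?thesis by (intro goal) simp
      qed
    next
      case 2
      then have rdY: "(r,c0) \<in> Y" using rd by auto
      have r: "1 \<le> r" "r < r0" using mem_iff_col_len[OF Y, of r c0] rdY lens 2 by auto
      define c where "c = row_len Y r"
      have c: "row_len (Y - {x}) r = c" using 2 other by (simp add: c_def)
      have sd: "(r,c) \<in> Y" "(r,Suc c) \<notin> Y" "c0 \<le> c"
        using mem_iff_row_len[OF Y, of r c] mem_iff_row_len[OF Y, of r "Suc c"]
          mem_iff_row_len[OF Y, of r c0] rdY by (auto simp: c_def)
      have lt0: "key (r,c) < key x" using lt 2 lens c x0 by simp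
      have goal: ?thesis if "key (r,c) + R + C \<le> key x" using that 2 lens c x0 by simp
      have dvd': "int e dvd (int c0 - int r0) - (int c - int r)" using dvd 2 lens c by simp
      show ?thesis
      proof (cases "(Suc r,c) \<in> Y")
        case False
        then have a: "(r,c) \<in> removable Y" using sd removable_iff[OF Y] by blast
        have "residue e (r,c) = residue e x" unfolding x0 using residue_eqI[OF dvd'] by simp
        with good_gap[OF reg g a] lt0 show ?thesis by (intro goal) simp
      next
        case True
        have "(Suc r,Suc c) \<notin> Y" using is_partition_down[OF Y, of "Suc r" "Suc c" r "Suc c"] sd r by auto
        then have c': "row_len Y (Suc r) = c" using True row_len_eqI[OF Y] by blast
        have "(Suc r,c0) \<in> Y" using is_partition_down[OF Y x1(3)] r x1 by auto
        moreover have "int e dvd (int c0 - int (Suc r0)) - (int c - int (Suc r))" using dvd' by (simp add: algebra_simps)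
        ultimately have "key (r,c) + R + R + C \<le> key x + R"
          using regularD[OF reg, of "Suc r" c0] lt0 c' lens(2) x0 by (simp add: key_Suc algebra_simps)
        then show ?thesis by (intro goal) (simp add: algebra_simps)
      qed
    next
      case 3
      then show ?thesis using regularD[OF reg, of r d] rd dvd lt other other' by auto
    qed
  qed
  then show ?thesis
    unfolding key_regular_def residue_eq_iff using Y' by (auto simp: key_Suc not_less algebra_simps)
qed

text \<open>The node of largest key is removable. An addable node of its residue above it would lie
  a full diagonal step higher, yet it exceeds some node of \<open>Y\<close> by only one row or
  column step. So the signature begins with a minus.\<close>

lemma key_regular_ex_good:
  assumes reg: "key_regular e key Y" and ne: "Y \<noteq> {}"
  shows "\<exists>i x. good key (node_sign Y) (signed_nodes e i Y) x"
proof -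
  have Y: "is_partition Y" using reg by (simp add: key_regular_def)
  have "finite Y" by (rule is_partition_finite[OF Y])
  then have "Max (key ` Y) \<in> key ` Y" using ne by (intro Max_in) auto
  then obtain x where "x \<in> Y" "key x = Max (key ` Y)" by auto
  then have x: "x \<in> Y" "\<And>n. n \<in> Y \<Longrightarrow> key n \<le> key x" using \<open>finite Y\<close> by auto
  obtain r c where rc: "x = (r,c)" by (cases x)
  have "(Suc r,c) \<notin> Y" "(r,Suc c) \<notin> Y"
    using x(2)[of "(Suc r,c)"] x(2)[of "(r,Suc c)"] R_pos C_pos unfolding rc key_Suc by auto
  then have rem: "x \<in> removable Y" using removable_iff[OF Y] rc x(1) by blast
  let ?S = "signed_nodes e (residue e x) Y"
  have xS: "x \<in> ?S" using rem by (auto simp: signed_nodes_def residue_def rc)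
  have "key n \<le> key x" if n: "n \<in> ?S" for n
  proof (rule ccontr)
    assume gt: "\<not> key n \<le> key x"
    then have "n \<notin> Y" using x(2) by blast
    then have a: "n \<in> addable Y" using n by (auto simp: signed_nodes_def removable_def)
    have gap: "key x + R + C \<le> key n"
      using addable_separated[OF reg a rem] gt mem_signed_nodes(3)[OF n] mem_signed_nodes(3)[OF xS] by simp
    obtain s d where sd: "n = (s,d)" by (cases n)
    have "1 \<le> r" "1 \<le> c" using is_partition_pos[OF Y] x(1) rc by auto
    \<comment> \<open>This excludes \<open>(1,1)\<close> as the addable node, the one case with no
      neighbour in the partition.\<close>
    then have "(1,1) \<in> Y" using is_partition_down[OF Y, of r c 1 1] x(1) rc by auto
    then have "(s-1,d) \<in> Y \<and> 1 \<le> s \<or> (s,d-1) \<in> Y \<and> 1 \<le> d"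
      using a sd addable_iff[OF Y, of s d] by auto
    then show False
      using x(2)[of "(s-1,d)"] x(2)[of "(s,d-1)"] key_minus_row[of s d] key_minus_col[of d s]
        gap sd R_pos C_pos by auto
  qed
  then have "?S = {n\<in>?S. key n \<le> key x}" by blast
  then have "sum (node_sign Y) ?S = sum (node_sign Y) {n\<in>?S. key n < key x} + node_sign Y x"
    using sum_le_split[OF finite_signed_nodes[OF Y] key_inj_on xS, of "node_sign Y"] by simp
  then have "sum (node_sign Y) ?S < sum (node_sign Y) {n\<in>?S. key n < key x}"
    using removable_sign[OF rem] by simp
  then show ?thesis
    using ex_good[where sg = "node_sign Y", OF finite_signed_nodes[OF Y] key_inj_on
        node_sign_cases downset_less] by blast
qed

lemma cogood_remove:
  assumes Y: "is_partition Y" and g: "good key (node_sign Y) (signed_nodes e i Y) x"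
  shows "cogood key (node_sign (Y - {x})) (signed_nodes e i (Y - {x})) x"
proof -
  have x: "x \<in> signed_nodes e i Y" "node_sign Y x = -1" using g by (auto simp: good_def)
  have rem: "x \<in> removable Y" "residue e x = i mod int e" using mem_signed_nodes[OF x(1)] x(2) by auto
  have e2: "2 \<le> e" using e3 by simp
  note sn = signed_nodes_remove[OF Y e2 rem]
  show ?thesis unfolding sn(1)
    by (rule good_imp_cogood_flip[OF g finite_signed_nodes[OF Y] key_inj_on sn(2)])
      (auto intro: addable_sign removable_imp_addable[OF Y rem(1)])
qed

end

section \<open>Ladders\<close>

text \<open>Corners of a diagram are detected by a second difference of its indicator function. As
  \<open>f\<close> is arbitrary, this makes every weighted corner count linear in the diagram, which
  is how ladder counts come to control signatures.\<close>

lemma boundary_sum: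
  fixes f :: "node \<Rightarrow> int"
  assumes Y: "is_partition Y"
  shows "(\<Sum>n\<in>addable Y. f n) - (\<Sum>(r,c)\<in>removable Y. f (Suc r, Suc c)) =
     f (1,1) + (\<Sum>(r,c)\<in>Y. f (Suc r, c) + f (r, Suc c) - f (r,c) - f (Suc r, Suc c))"
proof -
  have fin: "finite Y" "finite (addable Y)" "finite (removable Y)"
    using is_partition_finite[OF Y] finite_addable[OF Y] by (auto simp: removable_def)
  let ?E = "(\<lambda>(r,c). (Suc r, c)) ` Y" and ?F = "(\<lambda>(r,c). (r, Suc c)) ` Y"
    and ?G = "(\<lambda>(r,c). (Suc r, Suc c)) ` Y" and ?Q = "(\<lambda>(r,c). (Suc r, Suc c)) ` removable Y"
  \<comment> \<open>A finite set containing all the supports, so that every sum runs over the same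
    index set.\<close>
  define B where "B = insert (1,1) (?E \<union> ?F \<union> ?G \<union> ?Q \<union> Y \<union> addable Y)"
  have finB: "finite B" unfolding B_def using fin by simp
  have S: "sum f X = (\<Sum>v\<in>B. f v * of_bool (v \<in> X))" if "X \<subseteq> B" for X
  proof -
    have "sum f X = sum f (B \<inter> X)" using that by (simp add: Int_absorb1)
    also have "\<dots> = (\<Sum>v\<in>B. if v \<in> X then f v else 0)" using finB by (rule sum.inter_restrict)
    finally show ?thesis by (simp add: of_bool_def if_distrib cong: if_cong)
  qed
  have inj: "inj_on (\<lambda>(r,c). (Suc r, c)) X" "inj_on (\<lambda>(r,c). (r, Suc c)) X"
    "inj_on (\<lambda>(r,c). (Suc r, Suc c)) X" for X :: "node set"
    by (auto simp: inj_on_def)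
  have im: "(\<Sum>(r,c)\<in>X. f (Suc r, c)) = sum f ((\<lambda>(r,c). (Suc r, c)) ` X)"
    "(\<Sum>(r,c)\<in>X. f (r, Suc c)) = sum f ((\<lambda>(r,c). (r, Suc c)) ` X)"
    "(\<Sum>(r,c)\<in>X. f (Suc r, Suc c)) = sum f ((\<lambda>(r,c). (Suc r, Suc c)) ` X)" for X
    by (rule sum.reindex_cong[OF inj(1) refl, symmetric] sum.reindex_cong[OF inj(2) refl, symmetric]
        sum.reindex_cong[OF inj(3) refl, symmetric]; auto)+
  \<comment> \<open>Pointwise form, checked on the two-by-two block ending at \<open>v\<close>. The
    term at \<open>(1,1)\<close> corrects for the missing row and column 0.\<close>
  have pt: "of_bool (v \<in> addable Y) - of_bool (v \<in> ?Q) =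
      (of_bool (v \<in> {(1,1)}) + of_bool (v \<in> ?E) + of_bool (v \<in> ?F) - of_bool (v \<in> Y) - of_bool (v \<in> ?G) :: int)"
    for v
  proof -
    obtain r c where v: "v = (r,c)" by (cases v)
    have pos: "(0,b) \<notin> Y" "(b,0) \<notin> Y" for b using is_partition_pos[OF Y] by fastforce+
    have im: "(r,c) \<in> ?E \<longleftrightarrow> 1 \<le> r \<and> (r-1,c) \<in> Y" "(r,c) \<in> ?F \<longleftrightarrow> 1 \<le> c \<and> (r,c-1) \<in> Y"
      "(r,c) \<in> ?G \<longleftrightarrow> 1 \<le> r \<and> 1 \<le> c \<and> (r-1,c-1) \<in> Y"
      "(r,c) \<in> ?Q \<longleftrightarrow> 1 \<le> r \<and> 1 \<le> c \<and> (r-1,c-1) \<in> removable Y" for r c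
      by (cases r; cases c; force)+
    show ?thesis
    proof (cases "r = 0 \<or> c = 0")
      case True
      then show ?thesis unfolding v im addable_iff[OF Y] using pos by auto
    next
      case False
      then obtain a b where ab: "r = Suc a" "c = Suc b" by (metis not0_implies_Suc)
      have d1: "(Suc a,Suc b) \<in> Y \<Longrightarrow> a = 0 \<or> (a,Suc b) \<in> Y"
        "(Suc a,Suc b) \<in> Y \<Longrightarrow> b = 0 \<or> (Suc a,b) \<in> Y"
        "(a,Suc b) \<in> Y \<Longrightarrow> b = 0 \<or> (a,b) \<in> Y" "(Suc a,b) \<in> Y \<Longrightarrow> a = 0 \<or> (a,b) \<in> Y"
        using is_partition_down[OF Y, of "Suc a" "Suc b" a "Suc b"]
          is_partition_down[OF Y, of "Suc a" "Suc b" "Suc a" b]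
          is_partition_down[OF Y, of a "Suc b" a b] is_partition_down[OF Y, of "Suc a" b a b]
          is_partition_pos[OF Y, of a "Suc b"] is_partition_pos[OF Y, of "Suc a" b] by linarith+
      show ?thesis unfolding v im addable_iff[OF Y] removable_iff[OF Y] ab
        using d1 pos by (cases "a = 0"; cases "b = 0"; auto)
    qed
  qed
  have sub: "addable Y \<subseteq> B" "?Q \<subseteq> B" "{(1,1)} \<subseteq> B" "?E \<subseteq> B" "?F \<subseteq> B" "Y \<subseteq> B" "?G \<subseteq> B"
    unfolding B_def by blast+
  have "(\<Sum>n\<in>addable Y. f n) - sum f ?Q
      = (\<Sum>v\<in>B. f v * (of_bool (v \<in> addable Y) - of_bool (v \<in> ?Q)))"
    unfolding S[OF sub(1)] S[OF sub(2)] by (simp only: sum_subtractf right_diff_distrib)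
  also have "\<dots> = (\<Sum>v\<in>B. f v * (of_bool (v \<in> {(1,1)}) + of_bool (v \<in> ?E) + of_bool (v \<in> ?F)
       - of_bool (v \<in> Y) - of_bool (v \<in> ?G)))"
    unfolding pt ..
  also have "\<dots> = sum f {(1,1)} + sum f ?E + sum f ?F - sum f Y - sum f ?G"
    unfolding S[OF sub(3)] S[OF sub(4)] S[OF sub(5)] S[OF sub(6)] S[OF sub(7)]
    by (simp only: sum_subtractf sum.distrib right_diff_distrib distrib_left)
  finally show ?thesis
    unfolding im[symmetric] by (simp add: case_prod_unfold sum_subtractf sum.distrib)
qed

section \<open>Heights and ladder classes\<close>

definition ht :: "int \<Rightarrow> int \<Rightarrow> node \<Rightarrow> int" where
  "ht p q n = p * int (fst n) + q * int (snd n)"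

lemma ht_Suc: "ht p q (Suc r, c) = ht p q (r,c) + p" "ht p q (r, Suc c) = ht p q (r,c) + q"
  by (simp_all add: ht_def algebra_simps)

definition same_ladders :: "nat \<Rightarrow> int \<Rightarrow> int \<Rightarrow> node set \<Rightarrow> node set \<Rightarrow> bool" where
  "same_ladders e p q Y Z \<longleftrightarrow>
     (\<forall>t. card {n\<in>Y. (residue e n, ht p q n) = t} = card {n\<in>Z. (residue e n, ht p q n) = t})"

lemma same_ladders_sym: "same_ladders e p q Y Z \<Longrightarrow> same_ladders e p q Z Y"
  by (simp add: same_ladders_def)

lemma same_ladders_trans: "same_ladders e p q X Y \<Longrightarrow> same_ladders e p q Y Z \<Longrightarrow> same_ladders e p q X Z"
  by (simp add: same_ladders_def)

lemma same_ladders_refl: "same_ladders e p q Y Y"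
  by (simp add: same_ladders_def)

lemma same_ladders_sum:
  fixes g :: "int \<times> int \<Rightarrow> int"
  assumes eq: "same_ladders e p q Y Z" and fin: "finite Y" "finite Z"
  shows "(\<Sum>n\<in>Y. g (residue e n, ht p q n)) = (\<Sum>n\<in>Z. g (residue e n, ht p q n))"
proof -
  let ?c = "\<lambda>n. (residue e n, ht p q n)"
  have *: "(\<Sum>n\<in>X. g (?c n)) = (\<Sum>t\<in>?c ` Y \<union> ?c ` Z. int (card {n\<in>X. ?c n = t}) * g t)"
    if "finite X" "?c ` X \<subseteq> ?c ` Y \<union> ?c ` Z" for X
  proof -
    have "(\<Sum>n\<in>X. g (?c n)) = (\<Sum>t\<in>?c ` Y \<union> ?c ` Z. \<Sum>n\<in>{n\<in>X. ?c n = t}. g (?c n))"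
      by (rule sum.group[symmetric]) (use fin that in auto)
    also have "\<dots> = (\<Sum>t\<in>?c ` Y \<union> ?c ` Z. int (card {n\<in>X. ?c n = t}) * g t)"
      by (rule sum.cong) (auto simp del: prod.inject)
    finally show ?thesis .
  qed
  have "card {n\<in>Y. ?c n = t} = card {n\<in>Z. ?c n = t}" for t
    using eq unfolding same_ladders_def by blast
  then show ?thesis using *[of Y] *[of Z] fin by simp
qed

lemma same_ladders_card:
  assumes "same_ladders e p q Y Z" "finite Y" "finite Z"
  shows "card Y = card Z"
  using same_ladders_sum[OF assms, of "\<lambda>_. 1"] by simp

lemma card_class_insert:
  assumes "finite Y" "x \<notin> Y"
  shows "card {n \<in> insert x Y. P n} = card {n \<in> Y. P n} + (if P x then 1 else 0)"
proof -
  have "{n \<in> insert x Y. P n} = (if P x then insert x {n \<in> Y. P n} else {n \<in> Y. P n})" by auto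
  then show ?thesis using assms by simp
qed

lemma same_ladders_insert_iff:
  assumes "finite Y" "finite Z" "x \<notin> Y" "x' \<notin> Z"
    and "residue e x = residue e x'" "ht p q x = ht p q x'"
  shows "same_ladders e p q (insert x Y) (insert x' Z) \<longleftrightarrow> same_ladders e p q Y Z"
  unfolding same_ladders_def card_class_insert[OF assms(1,3)] card_class_insert[OF assms(2,4)]
    assms(5,6) add_right_cancel ..

section \<open>Lexicographic keys and height cuts of the signature\<close>

locale ladder_order =
  fixes e :: nat and p q s :: int
  assumes e_ge: "3 \<le> e" and p_pos: "0 < p" and q_pos: "0 < q" and s_nz: "s \<noteq> 0"

lemma poly_key:
  "[:0, p:] * of_nat a + [:s, q:] * of_nat b = [:s * int b, p * int a + q * int b :]"
  by (simp add: of_nat_poly mult.commute)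

lemma pCons_less_iff:
  fixes a b c d :: "'k::linordered_idom"
  shows "[:a, b:] < [:c, d:] \<longleftrightarrow> b < d \<or> (b = d \<and> a < c)"
  by (auto simp: less_poly_def pos_poly_pCons)

text \<open>\<open>int poly\<close> is ordered by leading coefficients, so the key compares heights first and breaks
  ties within a ladder by the column, in the direction given by the sign of \<open>s\<close>.\<close>
sublocale ladder_order \<subseteq> node_order e "[:0, p:]" "[:s, q:]"
proof
  show "[:0, p:] > 0" "[:s, q:] > 0" using p_pos q_pos pCons_less_iff[of 0 0] by (simp_all add: less_poly_def pos_poly_pCons)
  show "3 \<le> e" by (rule e_ge)
  show "a = a' \<and> b = b'"
    if "[:0, p:] * of_nat a + [:s, q:] * of_nat b = [:0, p:] * of_nat a' + [:s, q:] * of_nat b'"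
    for a b a' b'
    using that p_pos s_nz unfolding poly_key by auto
qed

text \<open>A removable node is entered at the height of its diagonal successor, the place where
  \<open>boundary_sum\<close> counts it.\<close>

definition cut :: "nat \<Rightarrow> int \<Rightarrow> int \<Rightarrow> int \<Rightarrow> node set \<Rightarrow> int \<Rightarrow> node set" where
  "cut e p q i Y K = {n \<in> signed_nodes e i Y. ht p q n + (if n \<in> addable Y then 0 else p + q) \<le> K}"

abbreviation cut_sum :: "nat \<Rightarrow> int \<Rightarrow> int \<Rightarrow> int \<Rightarrow> node set \<Rightarrow> int \<Rightarrow> int" where
  "cut_sum e p q i Y K \<equiv> sum (node_sign Y) (cut e p q i Y K)"

lemma residue_Suc:
  "residue e (Suc r, c) = (residue e (r,c) - 1) mod int e"
  "residue e (r, Suc c) = (residue e (r,c) + 1) mod int e"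
  "residue e (Suc r, Suc c) = residue e (r,c)"
proof -
  have "int c - int (Suc r) = (int c - int r) - 1" "int (Suc c) - int r = (int c - int r) + 1" by simp_all
  then show "residue e (Suc r, c) = (residue e (r,c) - 1) mod int e"
    "residue e (r, Suc c) = (residue e (r,c) + 1) mod int e"
    by (simp_all only: residue_def prod.case mod_diff_left_eq mod_add_left_eq)
qed (simp add: residue_def)

text \<open>Apply \<open>boundary_sum\<close> to the indicator of residue \<open>i\<close> and
  height at most \<open>K\<close>; its second difference at a node depends only on the residue and
  height of that node.\<close>

lemma cut_sum_same_ladders:
  assumes Y: "is_partition Y" and Z: "is_partition Z" and eq: "same_ladders e p q Y Z"
  shows "cut_sum e p q i Y K = cut_sum e p q i Z K"
proof -
  define f :: "node \<Rightarrow> int" where "f n = of_bool (residue e n = i mod int e \<and> ht p q n \<le> K)" for n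
  \<comment> \<open>The second difference of \<open>f\<close>, written as a function of residue and
    height alone.\<close>
  define g :: "int \<times> int \<Rightarrow> int" where "g = (\<lambda>(a,h). of_bool ((a - 1) mod int e = i mod int e \<and> h + p \<le> K)
     + of_bool ((a + 1) mod int e = i mod int e \<and> h + q \<le> K) - of_bool (a = i mod int e \<and> h \<le> K)
     - of_bool (a = i mod int e \<and> h + p + q \<le> K))"
  have *: "cut_sum e p q i X K = f (1,1) + (\<Sum>n\<in>X. g (residue e n, ht p q n))"
    if X: "is_partition X" for X
  proof -
    have fin: "finite X" "finite (addable X)" "finite (removable X)"
      using is_partition_finite[OF X] finite_addable[OF X] by (auto simp: removable_def)
    have disj: "addable X \<inter> removable X = {}"
      using addable_insert_removable[of _ X] removable_mem[of _ X] by blast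
    have "cut_sum e p q i X K = (\<Sum>n \<in> {n \<in> addable X. residue e n = i mod int e \<and> ht p q n \<le> K}
          \<union> {n \<in> removable X. residue e n = i mod int e \<and> ht p q n + (p + q) \<le> K}. node_sign X n)"
      by (rule sum.cong) (use disj in \<open>auto simp: cut_def signed_nodes_def\<close>)
    also have "\<dots> = (\<Sum>n \<in> {n \<in> addable X. residue e n = i mod int e \<and> ht p q n \<le> K}. node_sign X n)
       + (\<Sum>n \<in> {n \<in> removable X. residue e n = i mod int e \<and> ht p q n + (p + q) \<le> K}. node_sign X n)"
      by (rule sum.union_disjoint) (use fin disj in auto)
    also have "(\<Sum>n \<in> {n \<in> addable X. residue e n = i mod int e \<and> ht p q n \<le> K}. node_sign X n)
       = (\<Sum>n\<in>addable X. f n)"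
      using fin by (intro sum.mono_neutral_cong_left) (auto simp: f_def addable_sign)
    also have "(\<Sum>n \<in> {n \<in> removable X. residue e n = i mod int e \<and> ht p q n + (p + q) \<le> K}. node_sign X n)
       = (\<Sum>(r,c)\<in>removable X. - f (Suc r, Suc c))"
      using fin by (intro sum.mono_neutral_cong_left)
        (auto simp: f_def removable_sign ht_Suc residue_Suc(3) add_ac)
    finally have "cut_sum e p q i X K = (\<Sum>n\<in>addable X. f n) - (\<Sum>(r,c)\<in>removable X. f (Suc r, Suc c))"
      by (simp add: case_prod_unfold sum_negf)
    also have "\<dots> = f (1,1) + (\<Sum>(r,c)\<in>X. f (Suc r, c) + f (r, Suc c) - f (r,c) - f (Suc r, Suc c))"
      by (rule boundary_sum[OF X])
    also have "(\<Sum>(r,c)\<in>X. f (Suc r, c) + f (r, Suc c) - f (r,c) - f (Suc r, Suc c))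
        = (\<Sum>n\<in>X. g (residue e n, ht p q n))"
    proof (rule sum.cong[OF refl], clarify)
      fix r c
      have "f (Suc r, Suc c) = of_bool (residue e (r,c) = i mod int e \<and> ht p q (r,c) + p + q \<le> K)"
        by (simp add: f_def residue_Suc(3) ht_Suc add_ac)
      then show "f (Suc r, c) + f (r, Suc c) - f (r,c) - f (Suc r, Suc c)
          = g (residue e (r,c), ht p q (r,c))"
        by (simp add: f_def[of "(Suc r, c)"] f_def[of "(r, Suc c)"] f_def[of "(r, c)"] g_def
            residue_Suc[of e r c] ht_Suc)
    qed
    finally show ?thesis .
  qed
  show ?thesis
    unfolding *[OF Y] *[OF Z]
    using same_ladders_sum[OF eq is_partition_finite[OF Y] is_partition_finite[OF Z], of g] by simp
qed

context ladder_order
begin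

lemma key_less_iff:
  "key m < key n \<longleftrightarrow> ht p q m < ht p q n \<or> (ht p q m = ht p q n \<and> s * int (snd m) < s * int (snd n))"
  unfolding key_def poly_key ht_def by (rule pCons_less_iff)

lemma ht_less_imp: "ht p q m < ht p q n \<Longrightarrow> key m < key n"
  by (simp add: key_less_iff)

lemma key_le_imp: "key m \<le> key n \<Longrightarrow> ht p q m \<le> ht p q n"
  using ht_less_imp[of n m] by (meson not_less)

lemma key_gap_imp: "key m + [:0, p:] + [:s, q:] \<le> key n \<Longrightarrow> ht p q m + p + q \<le> ht p q n"
  using key_le_imp[of "(Suc (fst m), Suc (snd m))" n] by (simp add: key_Suc ht_Suc add_ac)

lemma signed_separated:
  assumes reg: "key_regular e key Y" and m: "m \<in> signed_nodes e i Y" "m \<in> addable Y"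
    and n: "n \<in> signed_nodes e i Y" "n \<notin> addable Y" and lt: "key n < key m"
  shows "ht p q n + p + q \<le> ht p q m"
proof (rule key_gap_imp, rule addable_separated[OF reg m(2) _ _ lt])
  show "n \<in> removable Y" using n by (auto simp: signed_nodes_def)
  show "residue e m = residue e n" using m n by (simp add: signed_nodes_def)
qed

text \<open>The shift could spoil the downset property only for an addable node in the cut with a
  removable node below it left out; separation puts the shifted removable node no higher than the
  addable one.\<close>

lemma downset_cut:
  assumes reg: "key_regular e key Y"
  shows "downset key (signed_nodes e i Y) (cut e p q i Y K)"
  unfolding downset_def
proof (intro conjI ballI impI)
  show "cut e p q i Y K \<subseteq> signed_nodes e i Y" by (auto simp: cut_def)
  fix m n assume m: "m \<in> cut e p q i Y K" and n: "n \<in> signed_nodes e i Y" and le: "key n \<le> key m"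
  have h: "ht p q n \<le> ht p q m" using le by (rule key_le_imp)
  have "ht p q n + p + q \<le> ht p q m" if "m \<in> addable Y" "n \<notin> addable Y"
  proof (rule signed_separated[OF reg _ that(1) n that(2)])
    show "m \<in> signed_nodes e i Y" using m by (simp add: cut_def)
    show "key n < key m" using le that key_inj by (metis order.not_eq_order_implies_strict)
  qed
  then show "n \<in> cut e p q i Y K"
    using m n h p_pos q_pos unfolding cut_def by (auto split: if_splits)
qed

text \<open>No tie is cut apart: addable nodes above \<open>x\<close> are at least
  \<open>p + q\<close> higher, and removable nodes below \<open>x\<close> remain below after their
  shift.\<close>

lemma cut_cogood:
  assumes reg: "key_regular e key Y" and g: "cogood key (node_sign Y) (signed_nodes e i Y) x"
  shows "cut e p q i Y (ht p q x) = {n \<in> signed_nodes e i Y. key n \<le> key x}"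
proof -
  have x: "x \<in> signed_nodes e i Y" "x \<in> addable Y"
    using g mem_signed_nodes(1)[of x e i Y] by (auto simp: cogood_def)
  have "key n \<le> key x" if n: "n \<in> cut e p q i Y (ht p q x)" for n
  proof (rule ccontr)
    assume "\<not> key n \<le> key x"
    then have lt: "key x < key n" by simp
    then have h: "ht p q x \<le> ht p q n" by (intro key_le_imp) simp
    have nS: "n \<in> signed_nodes e i Y" using n by (simp add: cut_def)
    have nA: "n \<in> addable Y" using n h p_pos q_pos by (auto simp: cut_def split: if_splits)
    have "residue e n = residue e x" using x nS by (simp add: signed_nodes_def)
    then have "ht p q x + p + q \<le> ht p q n" using cogood_gap[OF reg g nA _ lt] key_gap_imp by simp
    then show False using n nA p_pos q_pos by (simp add: cut_def)
  qed
  moreover have "n \<in> cut e p q i Y (ht p q x)" if n: "n \<in> signed_nodes e i Y" "key n \<le> key x" for n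
  proof (cases "n \<in> addable Y")
    case True
    then show ?thesis using n key_le_imp by (simp add: cut_def)
  next
    case False
    then have "key n < key x" using n x key_inj by (metis order.not_eq_order_implies_strict)
    then show ?thesis using signed_separated[OF reg x n(1) False] n False by (simp add: cut_def)
  qed
  moreover have "cut e p q i Y K \<subseteq> signed_nodes e i Y" for K by (auto simp: cut_def)
  ultimately show ?thesis by blast
qed

text \<open>The removable node \<open>x\<close> enters the cuts at \<open>ht p q x + p + q\<close>,
  so the threshold is the last integer before that.\<close>

lemma cut_good:
  assumes reg: "key_regular e key Y" and g: "good key (node_sign Y) (signed_nodes e i Y) x"
  shows "cut e p q i Y (ht p q x + p + q - 1) = {n \<in> signed_nodes e i Y. key n < key x}"
proof -
  have x: "x \<in> signed_nodes e i Y" "x \<in> removable Y"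
    using g mem_signed_nodes(2)[of x e i Y] by (auto simp: good_def)
  have xA: "x \<notin> addable Y" using x(2) removable_mem[of x Y] addable_insert_removable[of x Y] by blast
  have "key n < key x" if n: "n \<in> cut e p q i Y (ht p q x + p + q - 1)" for n
  proof (rule ccontr)
    assume le: "\<not> key n < key x"
    then have h: "ht p q x \<le> ht p q n" by (intro key_le_imp) simp
    have nS: "n \<in> signed_nodes e i Y" using n by (simp add: cut_def)
    have nA: "n \<in> addable Y" using n h by (auto simp: cut_def split: if_splits)
    then have "n \<noteq> x" using xA by blast
    then have "key x < key n" using le key_inj[of n x] by (meson linorder_neqE)
    then have "ht p q x + p + q \<le> ht p q n" using signed_separated[OF reg nS nA x(1) xA] by simp
    then show False using n nA by (simp add: cut_def)
  qed
  moreover have "n \<in> cut e p q i Y (ht p q x + p + q - 1)"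
    if n: "n \<in> signed_nodes e i Y" "key n < key x" for n
  proof (cases "n \<in> addable Y")
    case True
    then show ?thesis using n key_le_imp[of n x] p_pos q_pos by (simp add: cut_def)
  next
    case False
    then have r: "n \<in> removable Y" using n(1) by (auto simp: signed_nodes_def)
    have "residue e n = residue e x" using x n by (simp add: signed_nodes_def)
    then have "ht p q n + p + q \<le> ht p q x" using good_gap[OF reg g r _ n(2)] key_gap_imp by simp
    then show ?thesis using n False p_pos q_pos by (simp add: cut_def)
  qed
  moreover have "cut e p q i Y K \<subseteq> signed_nodes e i Y" for K by (auto simp: cut_def)
  ultimately show ?thesis by blast
qed

lemma cut_sum_cogood:
  assumes reg: "key_regular e key Y" and g: "cogood key (node_sign Y) (signed_nodes e i Y) x"
  shows "cut_sum e p q i Y K \<le> cut_sum e p q i Y (ht p q x)"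
    "K < ht p q x \<Longrightarrow> cut_sum e p q i Y K < cut_sum e p q i Y (ht p q x)"
proof -
  show "cut_sum e p q i Y K \<le> cut_sum e p q i Y (ht p q x)"
    using g downset_cut[OF reg] unfolding cut_cogood[OF reg g] cogood_def by blast
  assume "K < ht p q x"
  then have "x \<notin> cut e p q i Y K" using p_pos q_pos by (auto simp: cut_def split: if_splits)
  then show "cut_sum e p q i Y K < cut_sum e p q i Y (ht p q x)"
    using g downset_cut[OF reg] unfolding cut_cogood[OF reg g] cogood_def by blast
qed

lemma cut_sum_good:
  assumes reg: "key_regular e key Y" and g: "good key (node_sign Y) (signed_nodes e i Y) x"
  shows "cut_sum e p q i Y K \<le> cut_sum e p q i Y (ht p q x + p + q - 1)"
    "ht p q x + p + q - 1 < K \<Longrightarrow> cut_sum e p q i Y K < cut_sum e p q i Y (ht p q x + p + q - 1)"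
proof -
  show "cut_sum e p q i Y K \<le> cut_sum e p q i Y (ht p q x + p + q - 1)"
    using g downset_cut[OF reg] unfolding cut_good[OF reg g] good_def by blast
  assume "ht p q x + p + q - 1 < K"
  moreover have "x \<in> signed_nodes e i Y" using g by (simp add: good_def)
  ultimately have "x \<in> cut e p q i Y K" using p_pos q_pos by (auto simp: cut_def)
  then show "cut_sum e p q i Y K < cut_sum e p q i Y (ht p q x + p + q - 1)"
    using g downset_cut[OF reg] unfolding cut_good[OF reg g] good_def by blast
qed

lemma ht_pos: "1 \<le> fst n \<Longrightarrow> 0 < ht p q n"
  using p_pos q_pos by (simp add: ht_def add_pos_nonneg)

lemma ex_cogood_height:
  assumes reg: "key_regular e key Y" and H: "0 < H"
    and le: "\<And>K. cut_sum e p q i Y K \<le> cut_sum e p q i Y H"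
    and less: "\<And>K. K < H \<Longrightarrow> cut_sum e p q i Y K < cut_sum e p q i Y H"
  shows "\<exists>x. cogood key (node_sign Y) (signed_nodes e i Y) x \<and> ht p q x = H"
proof -
  have Y: "is_partition Y" using reg by (simp add: key_regular_def)
  have "0 < ht p q n" if "n \<in> signed_nodes e i Y" for n
  proof (rule ht_pos)
    show "1 \<le> fst n" using that is_partition_pos[OF Y, of "fst n" "snd n"]
      by (auto simp: signed_nodes_def addable_def removable_def)
  qed
  \<comment> \<open>All signed nodes have positive height, so the cut at 0 has sum 0 and the strict
    maximum at \<open>H > 0\<close> is positive; this forces an uncancelled plus.\<close>
  then have "cut e p q i Y 0 = {}" using p_pos q_pos by (force simp: cut_def)
  then have "0 < cut_sum e p q i Y H" using less[OF H] by simp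
  then obtain x where x: "cogood key (node_sign Y) (signed_nodes e i Y) x"
    using ex_cogood[where sg = "node_sign Y", OF finite_signed_nodes[OF Y] key_inj_on node_sign_cases downset_cut[OF reg]] by blast
  have "\<not> H < ht p q x" using cut_sum_cogood[OF reg x, of H] le[of "ht p q x"] by auto
  moreover have "\<not> ht p q x < H" using cut_sum_cogood(1)[OF reg x, of H] less[of "ht p q x"] by auto
  ultimately show ?thesis using x by (intro exI[of _ x]) auto
qed

lemma ex_good_height:
  assumes reg: "key_regular e key Y"
    and le: "\<And>K. cut_sum e p q i Y K \<le> cut_sum e p q i Y (H + p + q - 1)"
    and less: "\<And>K. H + p + q - 1 < K \<Longrightarrow> cut_sum e p q i Y K < cut_sum e p q i Y (H + p + q - 1)"
  shows "\<exists>x. good key (node_sign Y) (signed_nodes e i Y) x \<and> ht p q x = H"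
proof -
  have Y: "is_partition Y" using reg by (simp add: key_regular_def)
  let ?S = "signed_nodes e i Y"
  \<comment> \<open>Large enough for the cut to be the whole signed set, and beyond the last
    maximiser; the total sum is then below the maximum, which forces an uncancelled minus.\<close>
  define K where "K = Max (insert (H + p + q) ((\<lambda>n. ht p q n + p + q) ` ?S))"
  have fin: "finite ?S" by (rule finite_signed_nodes[OF Y])
  have K: "ht p q n + p + q \<le> K" if "n \<in> ?S" for n unfolding K_def using fin that by (intro Max_ge) auto
  have K': "H + p + q \<le> K" unfolding K_def using fin by (intro Max_ge) auto
  have "cut e p q i Y K = ?S" using K p_pos q_pos by (force simp: cut_def)
  then have "sum (node_sign Y) ?S < cut_sum e p q i Y (H + p + q - 1)" using less[of K] K' by simp
  then obtain x where x: "good key (node_sign Y) (signed_nodes e i Y) x"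
    using ex_good[where sg = "node_sign Y", OF fin key_inj_on node_sign_cases downset_cut[OF reg]] by blast
  let ?h = "ht p q x + p + q - 1"
  have "\<not> H < ht p q x" using cut_sum_good(1)[OF reg x, of "H + p + q - 1"] less[of ?h] by auto
  moreover have "\<not> ht p q x < H" using cut_sum_good(2)[OF reg x, of "H + p + q - 1"] le[of ?h] by auto
  ultimately show ?thesis using x by (intro exI[of _ x]) auto
qed

end

section \<open>Regular partitions in a ladder class\<close>

abbreviation ladder_key :: "int \<Rightarrow> int \<Rightarrow> int \<Rightarrow> node \<Rightarrow> int poly" where
  "ladder_key p q s \<equiv> node_order.key [:0, p:] [:s, q:]"

text \<open>Both partitions have the same cut sums, hence the same least maximiser. The tie-breaks
  \<open>s\<close> and \<open>s'\<close> may differ, so \<open>x'\<close> is only known to share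
  residue and height with \<open>x\<close>.\<close>

lemma cogood_transfer:
  assumes o: "ladder_order e p q s" "ladder_order e p q s'"
    and reg: "key_regular e (ladder_key p q s) Y" "key_regular e (ladder_key p q s') Z"
    and same: "same_ladders e p q Y Z"
    and g: "cogood (ladder_key p q s) (node_sign Y) (signed_nodes e i Y) x"
  obtains x' where "cogood (ladder_key p q s') (node_sign Z) (signed_nodes e i Z) x'"
    "residue e x' = residue e x" "ht p q x' = ht p q x"
proof -
  interpret a: ladder_order e p q s by fact
  interpret b: ladder_order e p q s' by fact
  have Y: "is_partition Y" and Z: "is_partition Z" using reg by (auto simp: key_regular_def)
  have eq: "cut_sum e p q i Y K = cut_sum e p q i Z K" for K
    by (rule cut_sum_same_ladders[OF Y Z same])
  have x: "x \<in> signed_nodes e i Y" "node_sign Y x = 1" using g by (auto simp: cogood_def)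
  have "x \<in> addable Y" using mem_signed_nodes[OF x(1)] x(2) by simp
  then have "1 \<le> fst x" by (auto simp: addable_def)
  then have h: "0 < ht p q x" by (rule a.ht_pos)
  obtain x' where x': "cogood (ladder_key p q s') (node_sign Z) (signed_nodes e i Z) x'"
    "ht p q x' = ht p q x"
    using b.ex_cogood_height[OF reg(2) h, of i] a.cut_sum_cogood[OF reg(1) g] unfolding eq by blast
  moreover have "residue e x' = residue e x"
    using x'(1) x(1) by (auto simp: cogood_def signed_nodes_def)
  ultimately show thesis using that by blast
qed

lemma good_transfer:
  assumes o: "ladder_order e p q s"
    and reg: "key_regular e (ladder_key p q s) Y" "key_regular e (ladder_key p q s) Z"
    and same: "same_ladders e p q Y Z"
    and g: "good (ladder_key p q s) (node_sign Y) (signed_nodes e i Y) x"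
  obtains x' where "good (ladder_key p q s) (node_sign Z) (signed_nodes e i Z) x'"
    "residue e x' = residue e x" "ht p q x' = ht p q x"
proof -
  interpret a: ladder_order e p q s by fact
  have Y: "is_partition Y" and Z: "is_partition Z" using reg by (auto simp: key_regular_def)
  have eq: "cut_sum e p q i Y K = cut_sum e p q i Z K" for K
    by (rule cut_sum_same_ladders[OF Y Z same])
  obtain x' where x': "good (ladder_key p q s) (node_sign Z) (signed_nodes e i Z) x'"
    "ht p q x' = ht p q x"
    using a.ex_good_height[OF reg(2), of i "ht p q x"] a.cut_sum_good[OF reg(1) g] unfolding eq by blast
  moreover have "residue e x' = residue e x"
    using x'(1) g by (auto simp: good_def signed_nodes_def)
  ultimately show thesis using that by blast
qed

lemma good_mem: "good k (node_sign Y) (signed_nodes e i Y) x \<Longrightarrow> x \<in> removable Y"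
  using mem_signed_nodes(2)[of x e i Y] by (simp add: good_def)

lemma cogood_mem: "cogood k (node_sign Y) (signed_nodes e i Y) x \<Longrightarrow> x \<in> addable Y"
  using mem_signed_nodes(1)[of x e i Y] by (simp add: cogood_def)

text \<open>Remove good nodes of equal residue and height from both partitions; the remainders are
  regular, lie in one class and agree by induction.\<close>

lemma key_regular_same_ladders_unique:
  assumes o: "ladder_order e p q s"
    and reg: "key_regular e (ladder_key p q s) Y" "key_regular e (ladder_key p q s) Z"
    and same: "same_ladders e p q Y Z"
  shows "Y = Z"
  using reg same
proof (induction "card Y" arbitrary: Y Z rule: less_induct)
  case less
  interpret a: ladder_order e p q s by fact
  have Y: "is_partition Y" and Z: "is_partition Z" using less.prems by (auto simp: key_regular_def)
  note fin = is_partition_finite[OF Y] is_partition_finite[OF Z]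
  have card: "card Y = card Z" using same_ladders_card[OF less.prems(3) fin] .
  show ?case
  proof (cases "Y = {}")
    case True
    then show ?thesis using card fin by simp
  next
    case False
    then obtain i x where x: "good (ladder_key p q s) (node_sign Y) (signed_nodes e i Y) x"
      using a.key_regular_ex_good[OF less.prems(1)] by blast
    obtain x' where x': "good (ladder_key p q s) (node_sign Z) (signed_nodes e i Z) x'"
      "residue e x' = residue e x" "ht p q x' = ht p q x"
      using good_transfer[OF o less.prems x] by blast
    have xY: "x \<in> Y" "x' \<in> Z" using good_mem[OF x] good_mem[OF x'(1)] by (auto simp: removable_def)
    have "same_ladders e p q (insert x (Y - {x})) (insert x' (Z - {x'}))"
      using less.prems(3) xY by (simp add: insert_absorb)
    then have same: "same_ladders e p q (Y - {x}) (Z - {x'})"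
      using same_ladders_insert_iff[of "Y - {x}" "Z - {x'}" x x' e p q] fin x'(2,3) by simp
    have "Y - {x} = Z - {x'}"
    proof (rule less.hyps)
      show "card (Y - {x}) < card Y" using fin xY by (intro psubset_card_mono) auto
    qed (use a.key_regular_remove[OF less.prems(1) x] a.key_regular_remove[OF less.prems(2) x'(1)] same
        in auto)
    \<comment> \<open>Each removed node is the cogood node of residue \<open>i\<close> of the common
      remainder, and there is only one.\<close>
    moreover from this have "x = x'"
      using cogood_unique[OF _ _ a.key_inj_on] a.cogood_remove[OF Y x] a.cogood_remove[OF Z x'(1)] by metis
    ultimately show ?thesis using xY by blast
  qed
qed

text \<open>A chain of good nodes emptying \<open>Y\<close> is retraced from the empty partition by
  cogood nodes for the other tie-break, each of the same residue and height as its
  counterpart.\<close>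

lemma key_regular_same_ladders_exists:
  assumes o: "ladder_order e p q s" "ladder_order e p q s'"
    and reg: "key_regular e (ladder_key p q s) Y"
  shows "\<exists>Z. key_regular e (ladder_key p q s') Z \<and> same_ladders e p q Y Z"
  using reg
proof (induction "card Y" arbitrary: Y rule: less_induct)
  case less
  interpret a: ladder_order e p q s by fact
  interpret b: ladder_order e p q s' by fact
  have Y: "is_partition Y" using less.prems by (auto simp: key_regular_def)
  note fin = is_partition_finite[OF Y]
  show ?case
  proof (cases "Y = {}")
    case True
    then show ?thesis using same_ladders_refl
      by (intro exI[of _ "{}"]) (auto simp: key_regular_def is_partition_def)
  next
    case False
    then obtain i x where x: "good (ladder_key p q s) (node_sign Y) (signed_nodes e i Y) x"
      using a.key_regular_ex_good[OF less.prems] by blast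
    have xY: "x \<in> Y" using good_mem[OF x] by (auto simp: removable_def)
    have reg': "key_regular e (ladder_key p q s) (Y - {x})" by (rule a.key_regular_remove[OF less.prems x])
    have "card (Y - {x}) < card Y" using fin xY by (intro psubset_card_mono) auto
    from less.hyps[OF this reg'] obtain Z where
      Z: "key_regular e (ladder_key p q s') Z" "same_ladders e p q (Y - {x}) Z" by blast
    obtain x' where x': "cogood (ladder_key p q s') (node_sign Z) (signed_nodes e i Z) x'"
      "residue e x' = residue e x" "ht p q x' = ht p q x"
      using cogood_transfer[OF o reg' Z a.cogood_remove[OF Y x]] by blast
    have "same_ladders e p q (insert x (Y - {x})) (insert x' Z)"
      using same_ladders_insert_iff[of "Y - {x}" Z x x' e p q] fin Z is_partition_finite[of Z] x'
        cogood_mem[OF x'(1)] addable_insert_removable[of x' Z] by (simp add: key_regular_def)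
    moreover have "insert x (Y - {x}) = Y" using xY by blast
    ultimately show ?thesis using b.key_regular_insert[OF Z(1) x'(1)] by auto
  qed
qed

section \<open>Arm sequences\<close>

text \<open>For \<open>y = p / z\<close>, the value \<open>s = -1\<close> selects the arm sequence \<open>A\<^sup>y\<^sup>+\<close> and \<open>s = 1\<close> selects \<open>A\<^sup>y\<^sup>-\<close>.\<close>
locale arm_order = ladder_order e p q s for e p q s +
  fixes z :: int and A :: "nat \<Rightarrow> int"
  assumes z_pos: "0 < z" and pq: "p + q = int e * z" and s_cases: "s = 1 \<or> s = -1"
    and A_bounds: "\<And>t. 1 \<le> t \<Longrightarrow>
      if s = 1 then z * A t < p * int t \<and> p * int t \<le> z * A t + z
      else z * A t \<le> p * int t \<and> p * int t < z * A t + z"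
begin

lemma le_A_iff:
  assumes "1 \<le> t"
  shows "a \<le> A t \<longleftrightarrow> (if s = 1 then z * a < p * int t else z * a \<le> p * int t)"
proof (cases "a \<le> A t")
  case True
  then have "z * a \<le> z * A t" using z_pos by simp
  then have "if s = 1 then z * a < p * int t else z * a \<le> p * int t"
    using A_bounds[OF assms] by (metis order.strict_trans1 order.trans)
  then show ?thesis using True by blast
next
  case False
  then have "z * (A t + 1) \<le> z * a" using z_pos by (intro mult_left_mono) auto
  then show ?thesis using A_bounds[OF assms] False by (auto simp: distrib_left split: if_splits)
qed

lemma eq_A_iff:
  assumes "1 \<le> t"
  shows "a = A t \<longleftrightarrow> (if s = 1 then z * a < p * int t \<and> p * int t \<le> z * a + z
     else z * a \<le> p * int t \<and> p * int t < z * a + z)"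
proof -
  have "a = A t \<longleftrightarrow> a \<le> A t \<and> \<not> a + 1 \<le> A t" by auto
  then show ?thesis unfolding le_A_iff[OF assms] by (auto simp: distrib_left)
qed

text \<open>Clearing the denominator of \<open>y = p / z\<close> turns the comparison of
  \<open>c - d\<close> with \<open>y t\<close> into a comparison of heights.\<close>

lemma ht_diff:
  assumes "int r' - int r + int c - int d = int e * t"
  shows "ht p q (r',d) - ht p q (r,c) = int e * (p * t - z * (int c - int d))"
proof -
  have "ht p q (r',d) - ht p q (r,c) = p * (int r' - int r + int c - int d) - (p + q) * (int c - int d)"
    by (simp add: ht_def algebra_simps)
  then show ?thesis unfolding assms pq by (simp add: algebra_simps)
qed

lemma e_pos: "0 < int e"
  using e_ge by simp

lemma node_prec_iff:
  assumes ne: "m \<noteq> n" and res: "residue e m = residue e n"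
  shows "node_prec e A m n \<longleftrightarrow> key m < key n"
proof -
  obtain r c where m: "m = (r,c)" by (cases m)
  obtain r' d where n: "n = (r',d)" by (cases n)
  have "int e dvd (int c - int r) - (int d - int r')" using res m n residue_eq_iff by simp
  then have "int e dvd int r' - int r + int c - int d" by (simp add: algebra_simps)
  then obtain t where t: "int r' - int r + int c - int d = int e * t" by (auto simp: dvd_def)
  then have dv: "(int r' - int r + int c - int d) div int e = t" using e_pos by simp
  define X where "X = p * t - z * (int c - int d)"
  have h: "ht p q n = ht p q m + int e * X" using ht_diff[OF t] m n by (simp add: X_def)
  have key: "key m < key n \<longleftrightarrow> 0 < X \<or> X = 0 \<and> s * int c < s * int d"
    unfolding key_less_iff h using e_pos by (auto simp: zero_less_mult_iff m n)
  consider "t = 0" | "0 < t" | "t < 0" by linarith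
  then show ?thesis
  proof cases
    case 1
    \<comment> \<open>For \<open>t = 0\<close> the nodes share a diagonal, along which height
      strictly increases, in agreement with \<open>A_0 = 0\<close>.\<close>
    have "\<not> (c = d)" using t 1 ne m n by auto
    then have X: "0 < X \<longleftrightarrow> c < d" "X \<noteq> 0" using 1 z_pos by (auto simp: X_def mult_less_0_iff)
    have "node_prec e A m n \<longleftrightarrow> int c - int d \<le> 0"
      unfolding m n node_prec_def prod.case Let_def dv using 1 by simp
    then show ?thesis using X \<open>c \<noteq> d\<close> unfolding key by auto
  next
    case 2
    then have prec: "node_prec e A m n \<longleftrightarrow> int c - int d \<le> A (nat t)"
      unfolding m n node_prec_def prod.case Let_def dv by simp
    \<comment> \<open>At equal heights a positive \<open>t\<close> forces \<open>d < c\<close>, so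
      the sign of \<open>s\<close> alone decides ties, just as it decides between floor and
      ceiling.\<close>
    have "0 < p * t" using 2 p_pos by simp
    then have "0 < z * (int c - int d)" if "X = 0" using that by (simp add: X_def)
    then have tie: "d < c" if "X = 0" using that z_pos by (auto simp: zero_less_mult_iff)
    show ?thesis unfolding prec key using le_A_iff[of "nat t" "int c - int d"] 2 tie s_cases
      by (auto simp: X_def split: if_splits)
  next
    case 3
    then have prec: "node_prec e A m n \<longleftrightarrow> \<not> int d - int c \<le> A (nat (- t))"
      unfolding m n node_prec_def prod.case Let_def dv by simp
    have "p * t < 0" using 3 p_pos by (simp add: mult_less_0_iff)
    then have "z * (int c - int d) < 0" if "X = 0" using that by (simp add: X_def)
    then have tie: "c < d" if "X = 0" using that z_pos by (auto simp: mult_less_0_iff)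
    have "z * (int d - int c) = - (z * (int c - int d))" by (simp add: algebra_simps)
    then show ?thesis unfolding prec key using le_A_iff[of "nat (- t)" "int d - int c"] 3 tie s_cases
      by (auto simp: X_def split: if_splits)
  qed
qed

text \<open>In units of \<open>e\<close>, the node below the foot is \<open>X = p t - z a\<close>
  higher than the hand, where \<open>a\<close> is the arm, and the diagonal successor is
  \<open>z\<close> higher. The arm equals \<open>A t\<close> when \<open>X\<close> lies in a
  half-open interval of length \<open>z\<close>; the tie-break selects which endpoint belongs to
  it.\<close>

lemma forbidden_hook_iff:
  assumes Y: "is_partition Y" and rd: "(r,d) \<in> Y"
  shows "(\<exists>t\<ge>1. hook_len Y (r,d) = int e * int t \<and> arm_len Y (r,d) = A t) \<longleftrightarrow>
    residue e (Suc (col_len Y d), d) = residue e (r, row_len Y r) \<and>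
    key (r, row_len Y r) < key (Suc (col_len Y d), d) \<and>
    key (Suc (col_len Y d), d) < key (Suc r, Suc (row_len Y r))"
proof -
  define b c where "b = col_len Y d" and "c = row_len Y r"
  have bc: "r \<le> b" "d \<le> c"
    using rd mem_iff_col_len[OF Y, of r d] mem_iff_row_len[OF Y, of r d] by (auto simp: b_def c_def)
  define L where "L = int (Suc b) - int r + int c - int d"
  have hook: "hook_len Y (r,d) = L" by (simp add: hook_len_def L_def b_def c_def)
  have L: "1 \<le> L" using bc by (simp add: L_def)
  have arm: "arm_len Y (r,d) = int c - int d" by (simp add: arm_len_def c_def)
  have res: "residue e (Suc b, d) = residue e (r,c) \<longleftrightarrow> int e dvd L"
  proof -
    have "(int d - int (Suc b)) - (int c - int r) = - L" by (simp add: L_def)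
    then show ?thesis unfolding residue_eq_iff by (metis dvd_minus_iff)
  qed
  have main: "int c - int d = A t \<longleftrightarrow>
      key (r,c) < key (Suc b, d) \<and> key (Suc b, d) < key (Suc r, Suc c)"
    if t: "1 \<le> t" "L = int e * int t" for t
  proof -
    define X where "X = p * int t - z * (int c - int d)"
    have h: "ht p q (Suc b, d) = ht p q (r,c) + int e * X"
      using ht_diff[of "Suc b" r c d "int t"] t by (simp add: X_def L_def)
    have h': "ht p q (Suc r, Suc c) = ht p q (r,c) + int e * z" using pq by (simp add: ht_Suc)
    have k1: "key (r,c) < key (Suc b, d) \<longleftrightarrow> 0 < X \<or> X = 0 \<and> s * int c < s * int d"
      unfolding key_less_iff h using e_pos by (auto simp: zero_less_mult_iff)
    have k2: "key (Suc b, d) < key (Suc r, Suc c) \<longleftrightarrow> X < z \<or> X = z \<and> s * int d < s * int (Suc c)"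
      unfolding key_less_iff h h' using e_pos by auto
    have "0 < p * int t" using t p_pos by simp
    then have "0 < z * (int c - int d)" if "X = 0" using that by (simp add: X_def)
    then have tie: "d < c" if "X = 0" using that z_pos by (auto simp: zero_less_mult_iff)
    show ?thesis unfolding eq_A_iff[OF t(1)] k1 k2 using tie s_cases bc by (auto simp: X_def)
  qed
  have "(\<exists>t\<ge>1. L = int e * int t \<and> int c - int d = A t) \<longleftrightarrow> int e dvd L \<and>
     key (r,c) < key (Suc b, d) \<and> key (Suc b, d) < key (Suc r, Suc c)" (is "?l \<longleftrightarrow> ?r")
  proof
    assume ?l
    then show ?r using main by auto
  next
    assume ?r
    then obtain k where k: "L = int e * k" by (auto simp: dvd_def)
    then have "0 < k" using L e_pos by (metis less_le_trans zero_less_mult_pos zero_less_one)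
    then have "1 \<le> nat k" "L = int e * int (nat k)" using k by auto
    then show ?l using main[of "nat k"] \<open>?r\<close> by blast
  qed
  then show ?thesis unfolding hook arm res[symmetric] b_def c_def .
qed

lemma A_regular_iff: "A_regular e A Y \<longleftrightarrow> key_regular e key Y"
proof (cases "is_partition Y")
  case True
  then show ?thesis using forbidden_hook_iff[OF True] unfolding A_regular_def key_regular_def by auto
qed (simp add: A_regular_def key_regular_def)

lemma f_op_iff:
  assumes "key_regular e key Y"
  shows "f_op e A i Y = Some Z \<longleftrightarrow>
    (\<exists>x. cogood key (node_sign Y) (signed_nodes e i Y) x \<and> Z = insert x Y)"
proof (rule f_op_eq_Some_iff[OF finite_signed_nodes key_inj_on node_prec_iff])
  show "is_partition Y" using assms by (simp add: key_regular_def)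
qed (auto simp: signed_nodes_def)

end

text \<open>The node added to \<open>Z\<close> has the residue and height of the one added to
  \<open>Y\<close>, so the result is a regular member of the class of \<open>Z2\<close> and equals
  it by uniqueness.\<close>

lemma f_op_transfer:
  assumes o: "arm_order e p q s z A" "arm_order e p q s' z B"
    and reg: "key_regular e (ladder_key p q s) Y" "key_regular e (ladder_key p q s') Z"
      "key_regular e (ladder_key p q s') Z2"
    and same: "same_ladders e p q Y Z" "same_ladders e p q Y2 Z2"
    and f: "f_op e A i Y = Some Y2"
  shows "f_op e B i Z = Some Z2"
proof -
  interpret a: arm_order e p q s z A by fact
  interpret b: arm_order e p q s' z B by fact
  have Y: "is_partition Y" and Z: "is_partition Z" using reg by (auto simp: key_regular_def)
  obtain x where x: "cogood (ladder_key p q s) (node_sign Y) (signed_nodes e i Y) x" "Y2 = insert x Y"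
    using f a.f_op_iff[OF reg(1)] by blast
  obtain x' where x': "cogood (ladder_key p q s') (node_sign Z) (signed_nodes e i Z) x'"
      "residue e x' = residue e x" "ht p q x' = ht p q x"
    using cogood_transfer[OF a.ladder_order_axioms b.ladder_order_axioms reg(1,2) same(1) x(1)] by blast
  have "x \<notin> Y" "x' \<notin> Z"
    using cogood_mem[OF x(1)] cogood_mem[OF x'(1)] addable_insert_removable by blast+
  then have "same_ladders e p q Y2 (insert x' Z)"
    using same_ladders_insert_iff[of Y Z x x' e p q] is_partition_finite Y Z x' same(1)
    unfolding x(2) by simp
  then have "same_ladders e p q (insert x' Z) Z2"
    using same(2) same_ladders_sym same_ladders_trans by blast
  then have "insert x' Z = Z2"
    using key_regular_same_ladders_unique[OF b.ladder_order_axioms b.key_regular_insert[OF reg(2) x'(1)] reg(3)]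
    by blast
  then show ?thesis using b.f_op_iff[OF reg(2)] x'(1) by blast
qed

text \<open>Height vanishes on the ladder direction \<open>(-q, p)\<close>, but also on its
  quotients by common factors of \<open>p\<close> and \<open>q\<close>; the congruence modulo
  \<open>e\<close> leaves only integer multiples of the direction itself.\<close>

lemma mem_ladder_iff:
  assumes e: "0 < e" and z: "0 < z" and p: "0 < p" and pq: "p + q = int e * z" and cop: "coprime p z"
    and e': "int e' = int e * z" and y': "int y' = p"
  shows "m \<in> ladder e' y' n \<longleftrightarrow> (residue e m, ht p q m) = (residue e n, ht p q n)"
proof -
  obtain r c where n: "n = (r,c)" by (cases n)
  obtain r' c' where m: "m = (r',c')" by (cases m)
  have q: "int y' - int e' = - q" using pq e' y' by simp
  have L: "m \<in> ladder e' y' n \<longleftrightarrow> (\<exists>k. int r' = int r - k * q \<and> int c' = int c + k * p)"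
    unfolding ladder_def n m q by (simp add: y')
  have R: "(residue e m, ht p q m) = (residue e n, ht p q n) \<longleftrightarrow>
      int e dvd (int c' - int r') - (int c - int r) \<and> p * int r' + q * int c' = p * int r + q * int c"
    by (simp add: n m residue_eq_iff ht_def)
  show ?thesis unfolding L R
  proof
    assume "\<exists>k. int r' = int r - k * q \<and> int c' = int c + k * p"
    then obtain k where k: "int r' = int r - k * q" "int c' = int c + k * p" by blast
    have "(int c' - int r') - (int c - int r) = k * (p + q)" unfolding k by (simp add: algebra_simps)
    then have "int e dvd (int c' - int r') - (int c - int r)" unfolding pq by simp
    moreover have "p * int r' + q * int c' = p * int r + q * int c" unfolding k by (simp add: algebra_simps)
    ultimately show "int e dvd (int c' - int r') - (int c - int r) \<and> p * int r' + q * int c' = p * int r + q * int c"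
      by blast
  next
    assume R: "int e dvd (int c' - int r') - (int c - int r) \<and> p * int r' + q * int c' = p * int r + q * int c"
    define u w where "u = int c' - int c" and "w = int r' - int r"
    have "(int c' - int r') - (int c - int r) = u - w" by (simp add: u_def w_def)
    then obtain t where t: "u - w = int e * t" using R by (metis dvdE)
    have "p * w + q * u = 0" using R by (simp add: u_def w_def algebra_simps)
    \<comment> \<open>Since \<open>p + q = e z\<close>, dividing by \<open>e\<close> leaves
      \<open>z u = p t\<close>; coprimality then makes \<open>z\<close> divide \<open>t\<close>, and
      \<open>t / z\<close> is the ladder step.\<close>
    moreover have "p * w + q * u = (p + q) * u - p * (u - w)" by (simp add: algebra_simps)
    ultimately have "int e * (z * u) = int e * (p * t)" unfolding pq t by (simp add: algebra_simps)
    then have zu: "z * u = p * t" using e by simp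
    then have "z dvd p * t" by (metis dvd_triv_left)
    then have "z dvd t" using cop by (metis coprime_commute coprime_dvd_mult_right_iff)
    then obtain k where k: "t = z * k" by (auto simp: dvd_def)
    have "z * u = z * (p * k)" using zu k by (simp add: algebra_simps)
    then have u: "u = p * k" using z by simp
    have "w = u - int e * z * k" using t k by (simp add: algebra_simps)
    then have "w = - q * k" unfolding u pq[symmetric] by (simp add: algebra_simps)
    then show "\<exists>k. int r' = int r - k * q \<and> int c' = int c + k * p"
      using u by (intro exI[of _ k]) (simp add: u_def w_def algebra_simps)
  qed
qed

section \<open>Ladder equivalence and the regular member of a class\<close>

lemma ladder_equiv_iff:
  assumes "0 < e" "0 < z" "0 < p" "p + q = int e * z" "coprime p z"
    "int e' = int e * z" "int y' = p"
  shows "ladder_equiv e' y' Y Z \<longleftrightarrow> same_ladders e p q Y Z"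
proof -
  have *: "X \<inter> ladder e' y' n = {m\<in>X. (residue e m, ht p q m) = (residue e n, ht p q n)}" for X n
    using mem_ladder_iff[OF assms] by blast
  show ?thesis
  proof
    assume L: "ladder_equiv e' y' Y Z"
    have "card {n\<in>Y. (residue e n, ht p q n) = t} = card {n\<in>Z. (residue e n, ht p q n) = t}" for t
    proof (cases "\<exists>n. (residue e n, ht p q n) = t")
      case True
      then show ?thesis using L unfolding ladder_equiv_def * by blast
    next
      case False
      then have "{n\<in>Y. (residue e n, ht p q n) = t} = {}" "{n\<in>Z. (residue e n, ht p q n) = t} = {}"
        by blast+
      then show ?thesis by (simp only:)
    qed
    then show "same_ladders e p q Y Z" unfolding same_ladders_def by blast
  qed (simp add: ladder_equiv_def same_ladders_def * del: prod.inject)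
qed

text \<open>A larger modulus tests fewer hooks. With \<open>e' = e z\<close> this carries regularity
  for the crystal over to the regularity that defines regularisation.\<close>

lemma key_regular_multiple:
  assumes "key_regular e k Y" "e dvd e'"
  shows "key_regular e' k Y"
proof -
  have "residue e m = residue e n" if "residue e' m = residue e' n" for m n
    using that assms(2) by (cases m; cases n) (auto simp: residue_eq_iff intro: dvd_trans[of "int e" "int e'"])
  then show ?thesis using assms(1) unfolding key_regular_def by blast
qed

text \<open>The description ranges over partitions regular for modulus \<open>e z\<close>, possibly
  not for modulus \<open>e\<close>. Uniqueness is therefore applied to the order with modulus
  \<open>e z\<close> and denominator 1, whose key is the same.\<close>

lemma the_key_regular:
  assumes o: "arm_order e p q s z A" "ladder_order e p q s'"
    and A': "arm_order e' p q s 1 A'" and cop: "coprime p z"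
    and e': "int e' = int e * z" and y': "int y' = p"
    and reg: "key_regular e (ladder_key p q s) Z"
    and same: "same_ladders e p q Y Z"
  shows "(THE Z. is_partition Z \<and> ladder_equiv e' y' Z Y \<and> A_regular e' A' Z) = Z"
proof -
  interpret a: arm_order e p q s z A by fact
  interpret b: arm_order e' p q s 1 A' by fact
  \<comment> \<open>The same ladders are described by residues modulo \<open>e\<close> here and
    modulo \<open>e'\<close> in \<open>l2\<close>; heights coincide because \<open>p + q\<close> is
    \<open>e z\<close> and also \<open>e'\<close> times 1.\<close>
  have l1: "ladder_equiv e' y' U V \<longleftrightarrow> same_ladders e p q U V" for U V
    by (rule ladder_equiv_iff[OF _ a.z_pos a.p_pos a.pq cop e' y']) (use a.e_pos in simp)
  have l2: "ladder_equiv e' y' U V \<longleftrightarrow> same_ladders e' p q U V" for U V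
    by (rule ladder_equiv_iff[OF _ _ a.p_pos b.pq]) (use b.e_pos y' in auto)
  have "int e dvd int e'" using e' by simp
  then have dvd: "e dvd e'" by simp
  have Z': "key_regular e' (ladder_key p q s) Z" by (rule key_regular_multiple[OF reg dvd])
  show ?thesis
  proof (rule the_equality)
    show "is_partition Z \<and> ladder_equiv e' y' Z Y \<and> A_regular e' A' Z"
      using reg Z' same_ladders_sym[OF same] by (simp add: l1 b.A_regular_iff key_regular_def)
    fix W assume W: "is_partition W \<and> ladder_equiv e' y' W Y \<and> A_regular e' A' W"
    then have "ladder_equiv e' y' W Z" using same same_ladders_trans unfolding l1 by blast
    then show "W = Z"
      using key_regular_same_ladders_unique[OF b.ladder_order_axioms _ Z'] W l2 b.A_regular_iff by blast
  qed
qed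

text \<open>A round trip ends at a regular partition in the ladder class of \<open>Y\<close>, which
  can only be \<open>Y\<close>.\<close>

lemma ladder_map_inverse:
  assumes A: "arm_order e p q s z A"
    and F: "\<And>Y. Y \<in> R_A e A \<Longrightarrow> F Y \<in> R_A e B \<and> same_ladders e p q Y (F Y)"
    and G: "\<And>Y. Y \<in> R_A e B \<Longrightarrow> G Y \<in> R_A e A \<and> same_ladders e p q Y (G Y)"
    and Y: "Y \<in> R_A e A"
  shows "G (F Y) = Y"
proof -
  interpret a: arm_order e p q s z A by fact
  have FG: "F Y \<in> R_A e B" "G (F Y) \<in> R_A e A" using F G Y by blast+
  have "same_ladders e p q (G (F Y)) Y" using F[OF Y] G[OF FG(1)] same_ladders_sym same_ladders_trans by blast
  then show ?thesis
    using key_regular_same_ladders_unique[OF a.ladder_order_axioms] FG(2) Y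
    by (simp add: R_A_def a.A_regular_iff)
qed

lemma crystal_iso_ladder_map:
  assumes A: "arm_order e p q s z A" and B: "arm_order e p q s' z B"
    and F: "\<And>Y. Y \<in> R_A e A \<Longrightarrow> F Y \<in> R_A e B \<and> same_ladders e p q Y (F Y)"
    and G: "\<And>Y. Y \<in> R_A e B \<Longrightarrow> G Y \<in> R_A e A \<and> same_ladders e p q Y (G Y)"
  shows "crystal_iso e A B F"
  unfolding crystal_iso_def
proof (intro conjI ballI allI)
  interpret a: arm_order e p q s z A by fact
  interpret b: arm_order e p q s' z B by fact
  show "bij_betw F (R_A e A) (R_A e B)"
    by (rule bij_betw_byWitness[where f' = G])
      (use F G ladder_map_inverse[OF A F G] ladder_map_inverse[OF B G F] in auto)
  fix Y Z i assume Y: "Y \<in> R_A e A" and Z: "Z \<in> R_A e A"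
  have reg: "key_regular e (ladder_key p q s) Y" "key_regular e (ladder_key p q s) Z"
    "key_regular e (ladder_key p q s') (F Y)" "key_regular e (ladder_key p q s') (F Z)"
    using F Y Z by (auto simp: R_A_def a.A_regular_iff b.A_regular_iff)
  have same: "same_ladders e p q Y (F Y)" "same_ladders e p q Z (F Z)" using F Y Z by blast+
  have "f_op e A i Y = Some Z \<longleftrightarrow> f_op e B i (F Y) = Some (F Z)"
    using f_op_transfer[OF A B reg(1,3,4) same]
      f_op_transfer[OF B A reg(3,1,2) same[THEN same_ladders_sym]] by blast
  then show "crystal_arrow e A Y i Z \<longleftrightarrow> crystal_arrow e B (F Y) i (F Z)"
    using F Y Z by (simp add: crystal_arrow_def)
qed

lemma regular_member_of_class:
  assumes A: "arm_order e p q s z A" and B: "arm_order e p q s' z B" and A': "arm_order e' p q s' 1 A'"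
    and cop: "coprime p z" and e': "int e' = int e * z" and y': "int y' = p" and Y: "Y \<in> R_A e A"
    and W: "W = (THE Z. is_partition Z \<and> ladder_equiv e' y' Z Y \<and> A_regular e' A' Z)"
  shows "W \<in> R_A e B \<and> same_ladders e p q Y W"
proof -
  interpret a: arm_order e p q s z A by fact
  interpret b: arm_order e p q s' z B by fact
  have "key_regular e (ladder_key p q s) Y" using Y by (simp add: R_A_def a.A_regular_iff)
  then obtain Z where Z: "key_regular e (ladder_key p q s') Z" "same_ladders e p q Y Z"
    using key_regular_same_ladders_exists[OF a.ladder_order_axioms b.ladder_order_axioms] by blast
  have "W = Z" unfolding W by (rule the_key_regular[OF B b.ladder_order_axioms A' cop e' y' Z])
  then show ?thesis using Z by (simp add: R_A_def b.A_regular_iff)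
qed

text \<open>For the integral slope \<open>y'\<close>, the sequence \<open>y' t - 1\<close> is the
  lower arm sequence, so regularity of ladders is an instance of arm regularity with
  \<open>s = 1\<close>.\<close>

lemma regularisation_eq_The:
  "regularisation e' y' Y =
    (THE Z. is_partition Z \<and> ladder_equiv e' y' Z Y \<and> A_regular e' (\<lambda>t. int y' * int t - 1) Z)"
  unfolding regularisation_def A_regular_def ey_regular_def by (rule arg_cong[of _ _ The]) auto

lemma restrictisation_eq_The:
  "restrictisation e' y' Y =
    (THE Z. is_partition Z \<and> ladder_equiv e' y' Z Y \<and> A_regular e' (\<lambda>t. int y' * int t) Z)"
  unfolding restrictisation_def A_regular_def ey_restricted_def by (rule arg_cong[of _ _ The]) auto

section \<open>Integer bounds for the arm sequences and conclusion\<close>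

lemma A_plus_bounds:
  assumes "0 < z" "y = of_int p / of_int z"
  shows "z * A_plus y t \<le> p * int t \<and> p * int t < z * A_plus y t + z"
proof -
  have z: "(0::rat) < of_int z" using assms(1) by simp
  have yt: "y * of_nat t = of_int (p * int t) / of_int z" unfolding assms(2) by simp
  have "of_int (A_plus y t) \<le> y * of_nat t" "y * of_nat t < of_int (A_plus y t) + 1"
    unfolding A_plus_def by linarith+
  then have "of_int (z * A_plus y t) \<le> (of_int (p * int t) :: rat)"
    "of_int (p * int t) < (of_int (z * A_plus y t + z) :: rat)"
    unfolding yt using z by (simp_all add: field_simps)
  then show ?thesis unfolding of_int_le_iff of_int_less_iff by blast
qed

lemma A_minus_bounds:
  assumes "0 < z" "y = of_int p / of_int z"
  shows "z * A_minus y t < p * int t \<and> p * int t \<le> z * A_minus y t + z"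
proof -
  have z: "(0::rat) < of_int z" using assms(1) by simp
  have yt: "y * of_nat t = of_int (p * int t) / of_int z" unfolding assms(2) by simp
  have "of_int (A_minus y t) < y * of_nat t" "y * of_nat t \<le> of_int (A_minus y t) + 1"
    unfolding A_minus_def by linarith+
  then have "of_int (z * A_minus y t) < (of_int (p * int t) :: rat)"
    "of_int (p * int t) \<le> (of_int (z * A_minus y t + z) :: rat)"
    unfolding yt using z by (simp_all add: field_simps)
  then show ?thesis unfolding of_int_le_iff of_int_less_iff by blast
qed

theorem mainTheorem6:
  fixes e :: nat and y :: rat and p z :: int
  assumes "e \<ge> 3"
    and "1 \<le> y" and "y \<le> of_nat e - 1"
    and "quotient_of y = (p, z)"
  shows "crystal_iso e (A_plus y) (A_minus y) (regularisation (e * nat z) (nat p))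
       \<and> crystal_iso e (A_minus y) (A_plus y) (restrictisation (e * nat z) (nat p))
       \<and> (\<forall>Y\<in>R_A e (A_plus y).
            restrictisation (e * nat z) (nat p) (regularisation (e * nat z) (nat p) Y) = Y)
       \<and> (\<forall>W\<in>R_A e (A_minus y).
            regularisation (e * nat z) (nat p) (restrictisation (e * nat z) (nat p) W) = W)"
proof -
  have z: "0 < z" and y: "y = of_int p / of_int z" and cop: "coprime p z"
    using assms(4) quotient_of_denom_pos quotient_of_div quotient_of_coprime by blast+
  have zr: "(0::rat) < of_int z" using z by simp
  define q where "q = int e * z - p"
  \<comment> \<open>The bounds on \<open>y\<close> enter only as signs: \<open>y >= 1\<close> gives
    \<open>p >= z > 0\<close>, and \<open>y <= e - 1\<close> gives
    \<open>q >= z > 0\<close>.\<close>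
  have "(of_int z :: rat) \<le> of_int p" using assms(2) zr unfolding y by (simp add: field_simps)
  then have zp: "z \<le> p" by (simp only: of_int_le_iff)
  then have p: "0 < p" using z by simp
  have "(of_int p :: rat) \<le> of_int ((int e - 1) * z)" using assms(3) zr unfolding y by (simp add: field_simps)
  then have "p \<le> (int e - 1) * z" by (simp only: of_int_le_iff)
  then have q: "0 < q" using z by (simp add: q_def left_diff_distrib)
  let ?e = "e * nat z" and ?y = "nat p"
  have e': "int ?e = int e * z" and y': "int ?y = p" using z p by simp_all
  have "1 \<le> nat z" using z by simp
  then have "e \<le> ?e" by simp
  then have e3: "3 \<le> ?e" using assms(1) by linarith
  have P: "arm_order e p q (-1) z (A_plus y)" and M: "arm_order e p q 1 z (A_minus y)"
    using A_plus_bounds[OF z y] A_minus_bounds[OF z y] assms(1) p q z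
    by (unfold_locales; simp add: q_def)+
  \<comment> \<open>The ladder parameters as an arm order with modulus \<open>e z\<close> and
    denominator 1, keeping \<open>p\<close>, \<open>q\<close> and \<open>s\<close>.\<close>
  have P': "arm_order ?e p q (-1) 1 (\<lambda>t. int ?y * int t)"
    and M': "arm_order ?e p q 1 1 (\<lambda>t. int ?y * int t - 1)"
    using e3 p q e' y' by (unfold_locales; simp add: q_def)+
  let ?F = "regularisation ?e ?y" and ?G = "restrictisation ?e ?y"
  have F: "?F Y \<in> R_A e (A_minus y) \<and> same_ladders e p q Y (?F Y)" if "Y \<in> R_A e (A_plus y)" for Y
    using regular_member_of_class[OF P M M' cop e' y' that regularisation_eq_The] .
  have G: "?G Y \<in> R_A e (A_plus y) \<and> same_ladders e p q Y (?G Y)" if "Y \<in> R_A e (A_minus y)" for Y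
    using regular_member_of_class[OF M P P' cop e' y' that restrictisation_eq_The] .
  show ?thesis
    using crystal_iso_ladder_map[OF P M F G] crystal_iso_ladder_map[OF M P G F]
      ladder_map_inverse[OF P F G] ladder_map_inverse[OF M G F] by blast
qed

end
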